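(* Let $3 \leq s \leq n$ be integers, and let $\mathbb{F}_q$ be a finite non-definite field (i.e. $q \equiv 1 \pmod 4$) with $q = p^k$, $p$ prime. Let $\epsilon, \epsilon' \in \{\pm1\}^n$ be sign patterns satisfying $\epsilon_1 = \dots = \epsilon_s = \epsilon'_1 = \dots = \epsilon'_s = 1$. Then for a function $f : \mathbb{F}_q \to \mathbb{F}_q$ the following are equivalent: (1) The entrywise transform $f[-]$ sends $LPM_n^{\mathbb{F}_q}(\epsilon')$ into $LPM_n^{\mathbb{F}_q}(\epsilon)$. (2) $\epsilon' = \epsilon$, and $f = c\cdot \mathrm{Frob}_p^\ell$ for some $0 \leq \ell \leq k-1$ and some $c \in \mathbb{F}_q^+$. Moreover, if $\mathbb{F}_q$ is a non-definite field whose order $q$ is a perfect square, then for any fixed $n \geq 2$ and $s = 2$ (that is, for sign patterns $\epsilon,\epsilon'\in\{\pm1\}^n$ with $\epsilon_1=\epsilon_2=\epsilon'_1=\epsilon'_2=1$), statements (1) and (2) are equivalent.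
   Context: An element of $\mathbb{F}_q^\times$ is positive if it is a nonzero square, and negative otherwise; $\mathbb{F}_q^+$ is the set of positive elements. The quadratic character $\chi$ takes the value $1$ on positive elements, $-1$ on negative elements, and $\chi(0)=0$. For $\epsilon \in \{\pm1\}^n$, $LPM_n^{\mathbb{F}_q}(\epsilon)$ is the set of symmetric matrices $A \in \mathbb{F}_q^{n\times n}$ such that for each $k=1,\dots,n$ the $k\times k$ leading principal minor of $A$ has quadratic character $\epsilon_k$. For $f:\mathbb{F}_q\to\mathbb{F}_q$, the entrywise transform $f[-]$ is $f[A] := (f(a_{ij}))_{i,j}$ for $A=(a_{ij})\in\mathbb{F}_q^{n\times n}$. $\mathrm{Frob}_p(x)=x^p$ is the Frobenius automorphism of $\mathbb{F}_q$, and $\mathrm{Frob}_p^\ell$ is its $\ell$-fold composition. *)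

theory Defs
  imports
    "HOL-Library.Cardinality"
    "HOL-Library.FuncSet"
    "HOL-Computational_Algebra.Primes"
    "HOL-Computational_Algebra.Nth_Powers"
    "Jordan_Normal_Form.Determinant"
begin

definition positive_elements :: "'a::finite_field set" where
  "positive_elements = {x. x \<noteq> 0 \<and> is_square x}"

definition quadratic_character :: "'a::finite_field \<Rightarrow> int" where
  "quadratic_character x =
     (if x = 0 then 0 else if x \<in> positive_elements then 1 else -1)"

text \<open>Elements of \<open>{\<plusminus>1}\<^sup>n\<close> are indexed by \<open>1, \<dots>, n\<close>, as are the leading minors; being
  extensional functions, two sign patterns are equal iff they agree on \<open>{1..n}\<close>.\<close>

definition sign_patterns :: "nat \<Rightarrow> (nat \<Rightarrow> int) set" where
  "sign_patterns n = {1..n} \<rightarrow>\<^sub>E {1, -1}"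

text \<open>Matrix entries are indexed from \<open>0\<close>, so the leading \<open>k \<times> k\<close> block has indices below \<open>k\<close>.\<close>

definition leading_principal_minor :: "nat \<Rightarrow> 'a::comm_ring_1 mat \<Rightarrow> 'a" where
  "leading_principal_minor k A = det (mat k k (\<lambda>(i, j). A $$ (i, j)))"

definition LPM :: "nat \<Rightarrow> (nat \<Rightarrow> int) \<Rightarrow> 'a::finite_field mat set" where
  "LPM n \<epsilon> = {A \<in> carrier_mat n n. transpose_mat A = A \<and>
     (\<forall>k\<in>{1..n}. quadratic_character (leading_principal_minor k A) = \<epsilon> k)}"

definition Frob :: "nat \<Rightarrow> 'a::finite_field \<Rightarrow> 'a" where
  "Frob p x = x ^ p"

end

theory Submission
  imports Defs "HOL-Number_Theory.Cong"
begin

text \<open>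
  Extending matrices by block sums \<open>A \<oplus> (d)\<close> shows that \<open>f\<close> also preserves the sign conditions on the
  leading \<open>2 \<times> 2\<close> (and \<open>3 \<times> 3\<close>) blocks; scale to \<open>f 1 = 1\<close>. Write \<open>S\<close> and \<open>N\<close> for the positive and
  the negative elements, and join \<open>x\<close> and \<open>y\<close> in the Paley graph if \<open>x - y \<in> S\<close>. The crucial identity is
  \<open>f a * f (b\<^sup>2 / a) = (f b)\<^sup>2\<close> for \<open>a \<in> S\<close>.

  If \<open>q = r\<^sup>2\<close>, the images of the lines \<open>s F\<^sub>r\<close> are cliques of the extremal size \<open>r\<close>, and an outside
  vertex is adjacent to exactly \<open>(r - 1) / 2\<close> vertices of such a clique. As \<open>(f b)\<^sup>2 / f a\<close> is adjacent to
  all vertices of the image of \<open>(b\<^sup>2 / a) F\<^sub>r\<close> except possibly \<open>f (b\<^sup>2 / a)\<close>, it equals the latter. If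
  \<open>s \<ge> 3\<close>, suitable \<open>3 \<times> 3\<close> matrices show that \<open>f\<close> is an automorphism of the Paley graph, and
  \<open>(f b)\<^sup>2 / f a\<close> has the same neighbours as \<open>f (b\<^sup>2 / a)\<close>.

  It follows that \<open>f\<close> is multiplicative and \<open>\<chi> (f x - f y) = \<chi> (x - y)\<close>, so \<open>f x = x ^ d\<close> with
  \<open>(x ^ d - y ^ d) ^ m = (x - y) ^ m\<close> for \<open>m = (q - 1) / 2\<close>. As in Carlitz's theorem, if \<open>p\<close> does not divide
  \<open>m choose j\<close>, then \<open>j d\<close> is congruent modulo \<open>q - 1\<close> to none of \<open>m + 1, \<dots>, q - 1\<close>; the choices
  \<open>j \<le> (p - 1) / 2\<close> and \<open>j = (p - 1) / 2 + p ^ i\<close> leave only the powers of \<open>p\<close>.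
\<close>

section \<open>Squares in a finite field\<close>

lemma card_power_eq_le:
  fixes c :: "'a :: {finite, idom}"
  assumes "n > 0"
  shows "card {x. x ^ n = c} \<le> n"
proof -
  have d: "degree (monom 1 n + [:-c:]) = n"
    using assms by (subst degree_add_eq_left) (auto simp: degree_monom_eq)
  then have nz: "monom 1 n + [:-c:] \<noteq> 0"
    using assms by auto
  have "{x. x ^ n = c} = {x. poly (monom 1 n + [:-c:]) x = 0}"
    by (auto simp: poly_monom add_eq_0_iff2)
  then show ?thesis
    using card_poly_roots_bound[OF nz] d by simp
qed

lemma card_le_fibres:
  assumes "finite A" "finite B" "f ` A \<subseteq> B" "\<And>y. y \<in> B \<Longrightarrow> card {x \<in> A. f x = y} \<le> n"
  shows "card A \<le> n * card B"
proof -
  have "card A \<le> card (\<Union>y\<in>B. {x \<in> A. f x = y})"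
    using assms by (intro card_mono) auto
  also have "\<dots> \<le> (\<Sum>y\<in>B. card {x \<in> A. f x = y})"
    using assms by (intro card_UN_le)
  also have "\<dots> \<le> (\<Sum>y\<in>B. n)"
    using assms by (intro sum_mono) auto
  finally show ?thesis by (simp add: mult.commute)
qed

section \<open>Euler's criterion and the quadratic character for \<open>q\<close> congruent to 1
  modulo 4\<close>

locale one_mod_four_field =
  fixes ty :: "'a :: finite_field itself"
  assumes card_mod_4: "CARD('a) mod 4 = 1"
begin

abbreviation "\<chi> \<equiv> quadratic_character :: 'a \<Rightarrow> int"
abbreviation "S \<equiv> positive_elements :: 'a set"

definition m :: nat where "m = (CARD('a) - 1) div 2"

lemma card_ge_5: "CARD('a) \<ge> 5"
proof -
  have "card {0, 1 :: 'a} \<le> CARD('a)" by (intro card_mono) auto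
  then have "CARD('a) \<ge> 2" by simp
  then show ?thesis using card_mod_4 by presburger
qed

lemma even_m: "even m" and q_eq: "CARD('a) = 2 * m + 1" and m_pos: "m > 0"
proof -
  obtain l where l: "CARD('a) = 4 * l + 1"
    using card_mod_4 by (metis mult_div_mod_eq)
  then show "even m" "CARD('a) = 2 * m + 1" "m > 0"
    using card_ge_5 unfolding m_def by (auto simp: l)
qed

text \<open>Translation by 1 permutes the field, so the sum of all elements equals itself plus
  \<open>q\<close> times 1.\<close>

lemma of_nat_q: "(of_nat CARD('a) :: 'a) = 0"
proof -
  have "(\<Sum>x\<in>UNIV. x :: 'a) = (\<Sum>x\<in>UNIV. x + 1)"
    by (rule sum.reindex_bij_witness[of _ "\<lambda>x. x + 1" "\<lambda>x. x - 1"]) auto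
  then show ?thesis by (simp add: sum.distrib)
qed

lemma two_neq_0: "(2 :: 'a) \<noteq> 0"
proof
  assume "(2 :: 'a) = 0"
  then have "(of_nat CARD('a) :: 'a) = 1" unfolding q_eq by simp
  then show False using of_nat_q by simp
qed

lemma one_neq_minus_1: "(1 :: 'a) \<noteq> -1"
  using two_neq_0 by (metis add.right_inverse one_add_one)

lemma power_q_minus_1:
  fixes x :: 'a
  assumes "x \<noteq> 0"
  shows "x ^ (CARD('a) - 1) = 1"
proof -
  have "x * x ^ (CARD('a) - 1) = x * 1"
    using finite_field_power_card_eq_same[of x] q_eq by simp
  then show ?thesis using assms by (metis mult_left_cancel)
qed

lemma zero_notin_S [simp]: "0 \<notin> S"
  by (simp add: positive_elements_def)

lemma square_in_S: "x \<noteq> 0 \<Longrightarrow> x ^ 2 \<in> S" for x :: 'a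
  by (simp add: positive_elements_def)

lemma SE:
  assumes "x \<in> S" obtains y where "y \<noteq> 0" "x = y ^ 2"
  using assms by (auto simp: positive_elements_def elim!: is_nth_powerE)

text \<open>Euler's criterion by counting: squares are roots of \<open>x ^ m = 1\<close>, which has
  at most \<open>m\<close> roots, and squaring is at most two-to-one, so there are at least
  \<open>m\<close> nonzero squares.\<close>

lemma S_eq: "S = {x. x ^ m = 1}" and card_S: "card S = m"
proof -
  have sub: "S \<subseteq> {x. x ^ m = 1}"
  proof
    fix x assume "x \<in> S"
    then obtain y where "y \<noteq> 0" "x = y ^ 2" by (rule SE)
    then show "x \<in> {x. x ^ m = 1}"
      using power_q_minus_1[of y] q_eq by (simp flip: power_mult)
  qed
  have "card (UNIV - {0 :: 'a}) \<le> 2 * card S"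
  proof (rule card_le_fibres[where f = "\<lambda>x. x ^ 2"])
    show "card {x \<in> UNIV - {0}. x ^ 2 = y} \<le> 2" for y :: 'a
      by (rule order.trans[OF card_mono card_power_eq_le[of 2 y]]) auto
  qed (use square_in_S in auto)
  then have 1: "card S \<ge> m" using q_eq by (simp add: card_Diff_subset)
  have 2: "card {x::'a. x ^ m = 1} \<le> m" by (rule card_power_eq_le[OF m_pos])
  show eq: "S = {x. x ^ m = 1}"
    by (rule card_seteq[OF _ sub]) (use 1 2 in auto)
  show "card S = m" using 1 2 eq by simp
qed

lemma of_int_chi: "of_int (\<chi> x) = x ^ m"
proof -
  have "x ^ m = -1" if "x \<noteq> 0" "x \<notin> S"
  proof -
    have "(x ^ m) ^ 2 = 1"
      using power_q_minus_1[OF that(1)] q_eq by (simp add: mult.commute flip: power_mult)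
    then have "x ^ m = 1 \<or> x ^ m = -1" by (simp add: power2_eq_1_iff)
    then show ?thesis using that S_eq by auto
  qed
  then show ?thesis
    using m_pos by (auto simp: quadratic_character_def S_eq power_0_left)
qed

lemma chi_cases: "\<chi> x = 0 \<or> \<chi> x = 1 \<or> \<chi> x = -1"
  by (auto simp: quadratic_character_def)

lemma chi_eq_iff: "\<chi> x = \<chi> y \<longleftrightarrow> x ^ m = y ^ m"
proof -
  have "of_int (\<chi> x) = (of_int (\<chi> y) :: 'a) \<Longrightarrow> \<chi> x = \<chi> y"
    using chi_cases[of x] chi_cases[of y] one_neq_minus_1 by (elim disjE) simp_all
  then show ?thesis by (auto simp flip: of_int_chi)
qed

lemma chi_mult: "\<chi> (x * y) = \<chi> x * \<chi> y"
proof -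
  have "of_int (\<chi> (x * y)) = (of_int (\<chi> x * \<chi> y) :: 'a)"
    by (simp add: of_int_chi power_mult_distrib)
  then show ?thesis
    using chi_cases[of x] chi_cases[of y] chi_cases[of "x * y"] one_neq_minus_1
    by (elim disjE) simp_all
qed

lemma chi_eq_0_iff [simp]: "\<chi> x = 0 \<longleftrightarrow> x = 0"
  by (auto simp: quadratic_character_def)

lemma chi_eq_1_iff: "\<chi> x = 1 \<longleftrightarrow> x \<in> S"
  by (auto simp: quadratic_character_def)

lemma chi_0 [simp]: "\<chi> 0 = 0" and chi_1 [simp]: "\<chi> 1 = 1"
  by (auto simp: quadratic_character_def positive_elements_def)

text \<open>As \<open>q\<close> is 1 modulo 4, \<open>m\<close> is even; hence -1 is a square and
  the Paley graph is undirected.\<close>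

lemma chi_minus [simp]: "\<chi> (- x) = \<chi> x"
  by (simp add: chi_eq_iff even_m power_minus_even)

lemma chi_diff_commute: "\<chi> (x - y) = \<chi> (y - x)"
  by (metis chi_minus minus_diff_eq)

lemma chi_power: "\<chi> (x ^ n) = \<chi> x ^ n"
  by (induction n) (simp_all add: chi_mult)

lemma chi_inverse: "\<chi> (inverse x) = \<chi> x"
proof (cases "x = 0")
  case False
  then have "\<chi> x * \<chi> (inverse x) = 1" by (simp flip: chi_mult)
  then show ?thesis using chi_cases[of x] by (elim disjE) auto
qed simp

lemma chi_divide: "\<chi> (x / y) = \<chi> x * \<chi> y"
  by (simp add: divide_inverse chi_mult chi_inverse)

lemma chi_abs_le: "\<chi> x \<le> 1" "\<chi> x \<ge> -1"
  using chi_cases[of x] by auto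

definition N :: "'a set" where "N = {x. \<chi> x = -1}"

lemma S_chi: "x \<in> S \<longleftrightarrow> \<chi> x = 1" and N_chi: "x \<in> N \<longleftrightarrow> \<chi> x = -1"
  by (auto simp: chi_eq_1_iff N_def)

lemma zero_notin_N [simp]: "0 \<notin> N"
  by (simp add: N_def)

lemma in_N_iff: "x \<in> N \<longleftrightarrow> x \<noteq> 0 \<and> x \<notin> S"
  using chi_cases[of x] by (auto simp: S_chi N_chi)

lemma UNIV_split: "UNIV = insert 0 (S \<union> N)" and S_Int_N: "S \<inter> N = {}"
  using in_N_iff by auto

lemma card_N: "card N = m"
proof -
  have "CARD('a) = card (insert 0 (S \<union> N))" using UNIV_split by simp
  also have "\<dots> = Suc (card S + card N)"
    by (simp add: card_Un_disjoint S_Int_N)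
  finally show ?thesis using card_S q_eq by simp
qed

lemma N_nonempty: obtains n where "n \<in> N"
  using card_N m_pos by (metis card.empty less_irrefl ex_in_conv)

lemma sum_UNIV_split: "(\<Sum>x\<in>UNIV. g x) = g 0 + (\<Sum>x\<in>S. g x) + (\<Sum>x\<in>N. g x)"
  for g :: "'a \<Rightarrow> 'b :: comm_monoid_add"
  by (subst UNIV_split) (simp add: sum.union_disjoint S_Int_N add.assoc)

section \<open>Character sums, and separating Paley graph vertices by their neighbours\<close>

lemma sum_chi: "(\<Sum>x\<in>UNIV. \<chi> x) = 0"
  by (simp add: sum_UNIV_split S_chi N_chi card_S card_N)

text \<open>For nonzero \<open>v\<close>, removing the square \<open>v ^ 2\<close> from
  \<open>v * (v - d)\<close> leaves \<open>\<chi> (1 - d / v)\<close>, and \<open>1 - d / v\<close>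
  runs through all elements except 1.\<close>

lemma sum_chi_mult_shift:
  assumes "d \<noteq> 0"
  shows "(\<Sum>v\<in>UNIV. \<chi> v * \<chi> (v - d)) = -1"
proof -
  have "(\<Sum>v\<in>UNIV. \<chi> v * \<chi> (v - d)) = (\<Sum>v\<in>UNIV-{0}. \<chi> v * \<chi> (v - d))"
    by (rule sum.mono_neutral_right) auto
  also have "\<dots> = (\<Sum>v\<in>UNIV-{0}. \<chi> (1 - d / v))"
  proof (rule sum.cong)
    fix v :: 'a assume "v \<in> UNIV - {0}"
    then have "v * (v - d) = v ^ 2 * (1 - d / v)" "\<chi> v ^ 2 = 1"
      using chi_cases[of v] by (auto simp: field_simps power2_eq_square)
    then show "\<chi> v * \<chi> (v - d) = \<chi> (1 - d / v)"
      by (metis chi_mult chi_power mult_1)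
  qed simp
  also have "\<dots> = (\<Sum>w\<in>UNIV-{1}. \<chi> w)"
    by (rule sum.reindex_bij_witness[of _ "\<lambda>w. d / (1 - w)" "\<lambda>v. 1 - d / v"])
       (use assms in \<open>auto simp: field_simps\<close>)
  also have "\<dots> = -1"
    using sum_chi by (simp add: sum_diff1)
  finally show ?thesis .
qed

lemma sum_chi_mult_diff:
  assumes "x \<noteq> y"
  shows "(\<Sum>v\<in>UNIV. \<chi> (v - x) * \<chi> (v - y)) = -1"
proof -
  have "(\<Sum>v\<in>UNIV. \<chi> (v - x) * \<chi> (v - y)) = (\<Sum>v\<in>UNIV. \<chi> v * \<chi> (v - (y - x)))"
    by (rule sum.reindex_bij_witness[of _ "\<lambda>v. v + x" "\<lambda>v. v - x"]) (auto simp: algebra_simps)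
  then show ?thesis using sum_chi_mult_shift[of "y - x"] assms by simp
qed

text \<open>For distinct \<open>c1\<close>, \<open>c2\<close> the correlation sum is -1, but
  \<open>S\<close>, 0 and \<open>N\<close> would together contribute at least
  \<open>m + 1 - (m - 2) = 3\<close>.\<close>

lemma twin_N:
  assumes c: "c1 \<in> N" "c2 \<in> N" and eq: "\<And>s. s \<in> S \<Longrightarrow> \<chi> (c1 - s) = \<chi> (c2 - s)"
  shows "c1 = c2"
proof (rule ccontr)
  assume ne: "c1 \<noteq> c2"
  have "(\<Sum>s\<in>S. \<chi> (s - c1) * \<chi> (s - c2)) = (\<Sum>s\<in>S. 1)"
  proof (rule sum.cong)
    fix s assume s: "s \<in> S"
    then have "\<chi> (s - c2) \<noteq> 0" using c by (auto simp: in_N_iff)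
    then show "\<chi> (s - c1) * \<chi> (s - c2) = 1"
      using eq[OF s] chi_cases[of "s - c2"] by (auto simp: chi_diff_commute)
  qed simp
  moreover have "(\<Sum>s\<in>N. \<chi> (s - c1) * \<chi> (s - c2)) = (\<Sum>s\<in>N-{c1,c2}. \<chi> (s - c1) * \<chi> (s - c2))"
    by (rule sum.mono_neutral_right) auto
  moreover have "\<dots> \<ge> (\<Sum>s\<in>N-{c1,c2}. -1)"
  proof (rule sum_mono)
    show "-1 \<le> \<chi> (s - c1) * \<chi> (s - c2)" for s
      using chi_abs_le by (simp flip: chi_mult)
  qed
  moreover have "card (N - {c1,c2}) = m - 2" "m \<ge> 2"
    using c ne card_N even_m m_pos by (auto simp: card_Diff_subset)
  moreover have "\<chi> (0 - c1) * \<chi> (0 - c2) = 1"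
    using c by (simp add: N_chi)
  ultimately show False
    using sum_chi_mult_diff[OF ne] card_S
    by (simp add: sum_UNIV_split of_nat_diff)
qed

text \<open>Equal neighbourhoods make every term of the correlation sum nonnegative, whereas for
  distinct vertices the sum is -1.\<close>

lemma twin_UNIV:
  assumes eq: "\<And>y. \<chi> (y - v) = 1 \<longleftrightarrow> \<chi> (y - w) = 1"
  shows "v = w"
proof (rule ccontr)
  assume ne: "v \<noteq> w"
  have "\<chi> (y - v) * \<chi> (y - w) \<ge> 0" if "y \<notin> {v,w}" for y
    using eq[of y] that chi_cases[of "y - v"] chi_cases[of "y - w"] by auto
  then have "0 \<le> (\<Sum>y\<in>UNIV. \<chi> (y - v) * \<chi> (y - w))"
    by (intro sum_nonneg) (metis chi_0 diff_self insert_iff mult_zero_left mult_zero_right order.refl singletonD)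
  then show False using sum_chi_mult_diff[OF ne] by simp
qed

end

section \<open>Power maps preserving the quadratic character of differences\<close>

text \<open>One step of Lucas' theorem: compare coefficients in
  \<open>(1 + X)^(p M + h) = (1 + X^p)^M (1 + X)^h\<close>.\<close>

lemma choose_step_mod_prime:
  fixes M J h a :: nat
  assumes "h < CHAR('a :: field_prime_char)" "a < CHAR('a)"
  shows "(of_nat ((CHAR('a) * M + h) choose (CHAR('a) * J + a)) :: 'a) =
         of_nat (M choose J) * of_nat (h choose a)"
proof -
  let ?p = "CHAR('a)"
  have p: "?p > 0" using assms by simp
  have "[:1, 1 :: 'a:] ^ (?p * M + h) = (1 + monom 1 1) ^ (?p * M + h)"
    by (simp add: monom_altdef one_pCons)
  also have "\<dots> = (1 + monom 1 ?p) ^ M * (1 + monom 1 1) ^ h"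
    by (simp add: power_add power_mult freshmans_dream monom_power)
  also have "\<dots> = (\<Sum>i\<le>M. \<Sum>b\<le>h. monom (of_nat (M choose i) * of_nat (h choose b)) (?p * i + b))"
    by (simp add: add.commute[of 1] binomial_ring sum_product monom_power mult_monom
        of_nat_monom flip: of_nat_mult)
  finally have "coeff ([:1, 1 :: 'a:] ^ (?p * M + h)) (?p * J + a) =
      (\<Sum>i\<le>M. \<Sum>b\<le>h. if ?p * i + b = ?p * J + a then of_nat (M choose i) * of_nat (h choose b) else 0)"
    by (simp add: coeff_sum)
  also have "\<dots> = (\<Sum>i\<le>M. \<Sum>b\<le>h. if b = a then if i = J then of_nat (M choose i) * of_nat (h choose b) else 0 else 0)"
  proof (intro sum.cong refl)
    fix i b assume "b \<in> {..h}"
    then have "b < ?p" using assms by simp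
    then have "?p * i + b = ?p * J + a \<longleftrightarrow> i = J \<and> b = a"
      using assms p by (metis add.commute div_mult_self2 div_less add_0 mod_less mod_mult_self2 less_numeral_extra(3))
    then show "(if ?p * i + b = ?p * J + a then of_nat (M choose i) * of_nat (h choose b) else 0) =
        (if b = a then if i = J then of_nat (M choose i) * of_nat (h choose b) else (0 :: 'a) else 0)"
      by simp
  qed
  also have "\<dots> = of_nat (M choose J) * of_nat (h choose a)"
    by (cases "a \<le> h"; cases "J \<le> M") (simp_all add: not_le binomial_eq_0)
  finally have "coeff ([:1, 1 :: 'a:] ^ (?p * M + h)) (?p * J + a) = of_nat (M choose J) * of_nat (h choose a)" .
  moreover have "coeff ([:1, 1 :: 'a:] ^ n) i = of_nat (n choose i)" for n i
    by (cases "i \<le> n")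
       (simp_all add: coeff_linear_poly_power coeff_eq_0 degree_power_eq binomial_eq_0)
  ultimately show ?thesis by metis
qed

lemma coeff_eq_0_if_zero_everywhere:
  fixes c :: "nat \<Rightarrow> 'a :: {finite, idom}"
  assumes "\<And>t. (\<Sum>i\<le>n. c i * t ^ i) = 0" "n < CARD('a)" "i \<le> n"
  shows "c i = 0"
proof -
  define P where "P = (\<Sum>i\<le>n. monom (c i) i)"
  have "P = 0"
  proof (rule ccontr)
    assume nz: "P \<noteq> 0"
    have "poly P t = 0" for t
      using assms(1)[of t] by (simp add: P_def poly_sum poly_monom)
    then have "CARD('a) \<le> degree P"
      using card_poly_roots_bound[OF nz] by simp
    moreover have "degree P \<le> n"
      unfolding P_def by (intro degree_sum_le) (auto intro: order.trans[OF degree_monom_le])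
    ultimately show False using assms(2) by simp
  qed
  then have "coeff P i = 0" by simp
  then show ?thesis using assms(3) by (simp add: P_def coeff_sum)
qed

text \<open>The least \<open>i\<close> satisfying the last inequality works. In base
  \<open>p\<close>, this shifts the leading digit of \<open>t\<close> to the top position
  \<open>k - 1\<close>.\<close>

lemma ex_prime_power_multiple:
  fixes p k t :: nat
  assumes "p > 1" "1 \<le> t" "t < p ^ k"
  shows "\<exists>i<k. p ^ i * t < p ^ k \<and> p ^ k \<le> p ^ Suc i * t"
proof -
  define i where "i = (LEAST i. p ^ k \<le> p ^ Suc i * t)"
  have k: "k > 0" using assms by (cases k) auto
  then have ex: "p ^ k \<le> p ^ Suc (k - 1) * t" using assms by simp
  have 1: "p ^ k \<le> p ^ Suc i * t" and 2: "i \<le> k - 1"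
    unfolding i_def by (rule LeastI[of _ "k - 1"], rule ex, rule Least_le, rule ex)
  have "p ^ i * t < p ^ k"
  proof (cases i)
    case (Suc j)
    then have "\<not> p ^ k \<le> p ^ Suc j * t"
      using not_less_Least[of j "\<lambda>i. p ^ k \<le> p ^ Suc i * t"] unfolding i_def by simp
    then show ?thesis using Suc by simp
  qed (use assms in simp)
  then show ?thesis using 1 2 k by (intro exI[of _ i]) auto
qed

section \<open>Power sums, multiplicative maps and exponents preserving the character of
  differences\<close>

context one_mod_four_field
begin

text \<open>Substituting \<open>y * x\<close> multiplies the sum by \<open>y ^ a\<close>, and
  \<open>a\<close> is too small for \<open>y ^ a = 1\<close> to hold for all nonzero
  \<open>y\<close>. For \<open>a = 0\<close> all \<open>q\<close> terms are 1, since
  \<open>0 ^ 0 = 1\<close>.\<close>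

lemma sum_power_eq_0:
  assumes "a < CARD('a) - 1"
  shows "(\<Sum>x\<in>UNIV. x ^ a :: 'a) = 0"
proof (cases "a = 0")
  case True
  then show ?thesis by (simp add: of_nat_q)
next
  case False
  have "\<exists>y::'a. y \<noteq> 0 \<and> y ^ a \<noteq> 1"
  proof (rule ccontr)
    assume "\<not> ?thesis"
    then have "card (UNIV - {0 :: 'a}) \<le> card {y::'a. y ^ a = 1}"
      by (intro card_mono) auto
    also have "\<dots> \<le> a" using False by (intro card_power_eq_le) simp
    finally show False using assms by (simp add: card_Diff_subset)
  qed
  then obtain y :: 'a where y: "y \<noteq> 0" "y ^ a \<noteq> 1" by blast
  have "(\<Sum>x\<in>UNIV. x ^ a :: 'a) = (\<Sum>x\<in>UNIV. (y * x) ^ a)"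
    by (rule sum.reindex_bij_witness[of _ "\<lambda>x. y * x" "\<lambda>x. x / y"]) (use y in auto)
  also have "\<dots> = y ^ a * (\<Sum>x\<in>UNIV. x ^ a)"
    by (simp add: power_mult_distrib sum_distrib_left)
  finally show ?thesis using y by auto
qed

lemma of_nat_card_minus_1: "(of_nat (CARD('a) - 1) :: 'a) = -1"
  using of_nat_q card_ge_5 by (simp add: of_nat_diff)

lemma sum_power_eq_minus_1:
  assumes "a > 0" "(CARD('a) - 1) dvd a"
  shows "(\<Sum>x\<in>UNIV. x ^ a :: 'a) = -1"
proof -
  have "(\<Sum>x\<in>UNIV. x ^ a :: 'a) = (\<Sum>x\<in>UNIV - {0}. x ^ a)"
    using assms by (intro sum.mono_neutral_right) auto
  also have "\<dots> = (\<Sum>x\<in>UNIV - {0 :: 'a}. 1)"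
    using assms by (intro sum.cong) (auto simp: power_q_minus_1 power_mult simp del: One_nat_def elim!: dvdE)
  finally show ?thesis using of_nat_card_minus_1 by (simp add: card_Diff_subset)
qed

lemma power_cong_exp:
  fixes x :: 'a
  assumes "[d = e] (mod (CARD('a) - 1))" "d > 0" "e > 0"
  shows "x ^ d = x ^ e"
proof (cases "x = 0")
  case False
  have "x ^ a = x ^ (a mod (CARD('a) - 1))" for a
  proof -
    have "x ^ a = x ^ ((CARD('a) - 1) * (a div (CARD('a) - 1)) + a mod (CARD('a) - 1))"
      by simp
    then show ?thesis
      unfolding power_add power_mult power_q_minus_1[OF False] by simp
  qed
  then show ?thesis using assms(1) unfolding cong_def by metis
qed (use assms in \<open>simp add: power_0_left\<close>)

text \<open>The character sums \<open>G e\<close> add up to \<open>- f 1\<close>, so some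
  \<open>G e\<close> is nonzero; substituting \<open>y * x\<close> in it gives
  \<open>f y * y ^ e = 1\<close> for nonzero \<open>y\<close>.\<close>

lemma multiplicative_imp_power:
  fixes f :: "'a \<Rightarrow> 'a"
  assumes mult: "\<And>x y. f (x * y) = f x * f y" and f01: "f 0 = 0" "f 1 = 1"
  obtains d where "1 \<le> d" "d \<le> CARD('a) - 1" "\<And>x. f x = x ^ d"
proof -
  define G where "G e = (\<Sum>x\<in>UNIV. f x * x ^ e)" for e
  have "(\<Sum>e<CARD('a) - 1. G e) = (\<Sum>x\<in>UNIV. f x * (\<Sum>e<CARD('a) - 1. x ^ e))"
    unfolding G_def sum_distrib_left by (rule sum.swap)
  also have "\<dots> = (\<Sum>x\<in>UNIV. if x = (1 :: 'a) then -1 else 0)"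
  proof (rule sum.cong)
    fix x :: 'a
    have "(\<Sum>e<CARD('a) - 1. x ^ e) = 0" if "x \<noteq> 0" "x \<noteq> 1"
      using that power_q_minus_1[of x] by (simp add: geometric_sum)
    then show "f x * (\<Sum>e<CARD('a) - 1. x ^ e) = (if x = 1 then -1 else 0)"
      using f01 of_nat_card_minus_1 by (cases "x = 0"; cases "x = 1") auto
  qed simp
  finally have "(\<Sum>e<CARD('a) - 1. G e) \<noteq> 0" by simp
  then obtain e where e: "e < CARD('a) - 1" "G e \<noteq> 0"
    by (metis (no_types, lifting) lessThan_iff sum.neutral)
  have "f y = y ^ (CARD('a) - 1 - e)" if y: "y \<noteq> 0" for y
  proof -
    have "G e = (\<Sum>x\<in>UNIV. f (y * x) * (y * x) ^ e)" unfolding G_def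
      by (rule sum.reindex_bij_witness[of _ "\<lambda>x. y * x" "\<lambda>x. x / y"]) (use y in auto)
    also have "\<dots> = (f y * y ^ e) * G e"
      by (simp add: G_def mult power_mult_distrib sum_distrib_left algebra_simps)
    finally have 1: "f y * y ^ e = 1" using e by simp
    have "y ^ (CARD('a) - 1 - e) * y ^ e = 1"
      using e power_q_minus_1[OF y] by (simp flip: power_add)
    with 1 show ?thesis using y by (metis mult_right_cancel power_not_zero)
  qed
  then have "f y = y ^ (CARD('a) - 1 - e)" for y
    using f01 e by (cases "y = 0") auto
  then show ?thesis using e by (intro that[of "CARD('a) - 1 - e"]) auto
qed

text \<open>Euler's criterion turns the invariance of \<open>\<chi>\<close> on differences into a
  power identity that the binomial theorem can expand.\<close>

definition chi_exponent :: "nat \<Rightarrow> bool" where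
  "chi_exponent d \<longleftrightarrow> (\<forall>x y :: 'a. (x ^ d - y ^ d) ^ m = (x - y) ^ m)"

lemma chi_exponent_surj:
  assumes "chi_exponent d"
  obtains y :: 'a where "y ^ d = t"
proof -
  have "inj (\<lambda>x::'a. x ^ d)"
  proof (rule injI)
    fix x y :: 'a assume "x ^ d = y ^ d"
    then have "(x - y) ^ m = 0"
      using assms m_pos unfolding chi_exponent_def by (metis diff_self power_0_left less_irrefl)
    then show "x = y" by simp
  qed
  then have "surj (\<lambda>x::'a. x ^ d)" by (simp add: finite_UNIV_inj_surj)
  then show ?thesis using that by (metis surjD)
qed

lemma chi_exponent_cong:
  assumes "chi_exponent d" "[d = e] (mod (CARD('a) - 1))" "d > 0" "e > 0"
  shows "chi_exponent e"
  using assms power_cong_exp[OF assms(2-4)] unfolding chi_exponent_def by simp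

text \<open>Multiply the identity defining \<open>chi_exponent\<close> by \<open>x ^ r\<close> and
  sum over \<open>x\<close>. The side with \<open>(x - y) ^ m\<close> vanishes. The other is a
  polynomial in \<open>- (y ^ d)\<close> of degree at most \<open>m < q\<close>, so its coefficients
  vanish; but the one at \<open>m - j\<close> is \<open>- (m choose j)\<close>.\<close>

lemma chi_exponent_residue:
  assumes good: "chi_exponent d" and "d > 0" and j: "1 \<le> j" "j \<le> m" "(of_nat (m choose j) :: 'a) \<noteq> 0"
    and e: "[j * d = e] (mod (CARD('a) - 1))" "m < e" "e \<le> CARD('a) - 1"
  shows False
proof -
  define r where "r = CARD('a) - 1 - e"
  define c :: "nat \<Rightarrow> 'a" where "c i = of_nat (m choose i) * (\<Sum>x\<in>UNIV. x ^ (d * (m - i) + r))" for i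
  have low: "(\<Sum>x\<in>UNIV. (x - y) ^ m * x ^ r) = 0" for y :: 'a
  proof -
    have "(\<Sum>x\<in>UNIV. (x - y) ^ m * x ^ r) =
      (\<Sum>x\<in>UNIV. \<Sum>i\<le>m. of_nat (m choose i) * (- y) ^ (m - i) * x ^ (i + r))"
    proof (rule sum.cong)
      fix x :: 'a
      have "(x - y) ^ m * x ^ r = (x + (- y)) ^ m * x ^ r" by simp
      then show "(x - y) ^ m * x ^ r = (\<Sum>i\<le>m. of_nat (m choose i) * (- y) ^ (m - i) * x ^ (i + r))"
        unfolding binomial_ring sum_distrib_right by (simp add: power_add mult_ac)
    qed simp
    also have "\<dots> = (\<Sum>i\<le>m. of_nat (m choose i) * (- y) ^ (m - i) * (\<Sum>x\<in>UNIV. x ^ (i + r)))"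
      by (subst sum.swap) (simp add: sum_distrib_left)
    \<comment> \<open>The exponents \<open>i + r\<close> stay below \<open>q - 1\<close> because
      \<open>m < e\<close>.\<close>
    also have "\<dots> = 0"
      using e q_eq unfolding r_def by (intro sum.neutral ballI) (simp add: sum_power_eq_0)
    finally show ?thesis .
  qed
  have "(\<Sum>i\<le>m. c i * t ^ i) = 0" for t
  proof -
    obtain y where y: "y ^ d = - t" using chi_exponent_surj[OF good] by blast
    have "(\<Sum>x\<in>UNIV. (x ^ d - y ^ d) ^ m * x ^ r) = 0"
      using low[of y] good unfolding chi_exponent_def by simp
    also have "(\<Sum>x\<in>UNIV. (x ^ d - y ^ d) ^ m * x ^ r) =
        (\<Sum>x\<in>UNIV. \<Sum>i\<le>m. of_nat (m choose i) * t ^ i * x ^ (d * (m - i) + r))"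
    proof (rule sum.cong)
      fix x :: 'a
      have "(x ^ d - y ^ d) ^ m * x ^ r = (t + x ^ d) ^ m * x ^ r"
        by (simp add: y add.commute)
      then show "(x ^ d - y ^ d) ^ m * x ^ r = (\<Sum>i\<le>m. of_nat (m choose i) * t ^ i * x ^ (d * (m - i) + r))"
        unfolding binomial_ring sum_distrib_right by (simp add: power_add power_mult mult.assoc)
    qed simp
    also have "\<dots> = (\<Sum>i\<le>m. c i * t ^ i)"
      by (subst sum.swap) (simp add: c_def sum_distrib_left sum_distrib_right algebra_simps)
    finally show ?thesis .
  qed
  then have "c (m - j) = 0"
    by (rule coeff_eq_0_if_zero_everywhere) (use q_eq in auto)
  moreover have "(\<Sum>x\<in>UNIV. x ^ (d * j + r) :: 'a) = -1"
  proof (rule sum_power_eq_minus_1)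
    have "[j * d + r = e + r] (mod (CARD('a) - 1))"
      using e by (intro cong_add) auto
    then show "CARD('a) - 1 dvd d * j + r"
      using e by (simp add: r_def mult.commute cong_dvd_iff)
  qed (use j \<open>d > 0\<close> in simp)
  ultimately show False
    using j binomial_symmetric[of j m] by (auto simp: c_def)
qed

end

section \<open>Base \<open>p\<close> digits of \<open>m\<close> and the classification of the
  exponents\<close>

locale one_mod_four_field_char = one_mod_four_field ty
  for ty :: "'a :: finite_field itself" +
  fixes p k :: nat
  assumes prime_p: "prime p" and card_eq: "CARD('a) = p ^ k"
begin

lemma CHAR_eq: "CHAR('a) = p"
proof -
  have "(of_nat p :: 'a) ^ k = 0"
    using of_nat_q by (simp add: card_eq)
  then have "(of_nat p :: 'a) = 0" by simp
  then show ?thesis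
    using prime_p CHAR_prime[where 'a = 'a] by (simp add: of_nat_eq_0_iff_char_dvd primes_dvd_imp_eq)
qed

definition h where "h = (p - 1) div 2"

lemma k_pos: "k > 0"
  using card_eq card_ge_5 by (cases k) auto

lemma odd_p: "odd p"
  using card_eq q_eq k_pos by (metis even_Suc even_mult_iff even_numeral even_power Suc_eq_plus1)

lemma p_eq: "p = 2 * h + 1" and h_pos: "h \<ge> 1"
proof -
  show "p = 2 * h + 1" using odd_p unfolding h_def by presburger
  then show "h \<ge> 1" using prime_gt_1_nat[OF prime_p] by simp
qed

lemma p_gt_1: "p > 1"
  using prime_p by (rule prime_gt_1_nat)

lemma frob_diff: "(x - y) ^ p ^ i = x ^ p ^ i - y ^ p ^ i" for x y :: 'a
proof -
  have "x ^ p ^ i = (x - y + y) ^ p ^ i" by simp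
  also have "\<dots> = (x - y) ^ p ^ i + y ^ p ^ i"
    using freshmans_dream'[of "p ^ i" i "x - y" y] CHAR_eq CHAR_prime by metis
  finally show ?thesis by simp
qed

lemma chi_frob: "\<chi> (x ^ p ^ i) = \<chi> x"
proof -
  have "odd (p ^ i)" using odd_p by simp
  moreover have "p ^ i > 0" using odd_p by (simp add: odd_pos)
  ultimately show ?thesis using chi_cases[of x] by (auto simp: chi_power)
qed

lemma chi_exponent_mult_power:
  assumes "chi_exponent d"
  shows "chi_exponent (p ^ i * d)"
  unfolding chi_exponent_def
proof (intro allI)
  fix x y :: 'a
  have "(x ^ (p ^ i * d) - y ^ (p ^ i * d)) ^ m = (x ^ p ^ i - y ^ p ^ i) ^ m"
    using assms unfolding chi_exponent_def power_mult by simp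
  also have "\<dots> = (x - y) ^ m"
    unfolding frob_diff[symmetric] using chi_frob chi_eq_iff by blast
  finally show "(x ^ (p ^ i * d) - y ^ (p ^ i * d)) ^ m = (x - y) ^ m" .
qed

lemma choose_h_neq_0:
  assumes "a \<le> h"
  shows "(of_nat (h choose a) :: 'a) \<noteq> 0"
proof
  assume "(of_nat (h choose a) :: 'a) = 0"
  then have "p dvd (h choose a)" by (simp add: of_nat_eq_0_iff_char_dvd CHAR_eq)
  then have "p dvd fact h"
    using assms by (metis binomial_fact_lemma dvd_mult)
  then show False using prime_p p_eq by (simp add: prime_dvd_fact_iff)
qed

text \<open>All base \<open>p\<close> digits of \<open>(p ^ l - 1) div 2\<close> equal
  \<open>h\<close>; Lucas' theorem peels off the lowest one.\<close>

lemma choose_m_step: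
  assumes "a \<le> h"
  shows "(of_nat ((p ^ Suc l - 1) div 2 choose (p * J + a)) :: 'a) =
    of_nat ((p ^ l - 1) div 2 choose J) * of_nat (h choose a)"
proof -
  have "odd (p ^ l)" using odd_p by simp
  then obtain b where "p ^ l = 2 * b + 1" by (rule oddE)
  then have "(p ^ Suc l - 1) div 2 = p * ((p ^ l - 1) div 2) + h"
    using p_eq by (simp add: algebra_simps)
  then show ?thesis
    using choose_step_mod_prime[where 'a = 'a, of h a] assms p_eq by (simp add: CHAR_eq)
qed

lemma m_eq: "m = (p ^ k - 1) div 2"
  by (simp add: m_def card_eq)

lemma choose_m_small:
  assumes "a \<le> h"
  shows "(of_nat (m choose a) :: 'a) \<noteq> 0"
  using choose_m_step[OF assms, of "k - 1" 0] k_pos choose_h_neq_0[OF assms] by (simp add: m_eq)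

lemma choose_power_p:
  assumes "i < l"
  shows "(of_nat ((p ^ l - 1) div 2 choose (p ^ i)) :: 'a) \<noteq> 0"
  using assms
proof (induction i arbitrary: l)
  case 0
  then obtain l' where "l = Suc l'" by (cases l) auto
  then show ?case
    using choose_m_step[of 1 l' 0] h_pos choose_h_neq_0[of 1] by simp
next
  case (Suc i)
  then obtain l' where "l = Suc l'" "i < l'" by (cases l) auto
  then show ?case
    using choose_m_step[of 0 l' "p ^ i"] Suc.IH[of l'] by simp
qed

text \<open>The digits of \<open>h + p ^ i\<close> are \<open>h\<close> at position 0 and 1 at
  position \<open>i\<close>, none above the corresponding digit \<open>h\<close> of
  \<open>m\<close>.\<close>

lemma choose_m_h_plus_power:
  assumes "1 \<le> i" "i < k"
  shows "(of_nat (m choose (h + p ^ i)) :: 'a) \<noteq> 0"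
proof -
  have "h + p ^ i = p * p ^ (i - 1) + h" "i - 1 < k - 1" "k = Suc (k - 1)"
    using assms by (auto simp flip: power_Suc)
  then show ?thesis
    using choose_m_step[of h "k - 1" "p ^ (i - 1)"] choose_power_p choose_h_neq_0[of h]
    by (metis m_eq no_zero_divisors order.refl)
qed

text \<open>Induction on \<open>j\<close>: from \<open>j * d \<le> m\<close> and
  \<open>d \<le> m\<close> follows \<open>Suc j * d \<le> 2 * m = q - 1\<close>, and in this range
  residues above \<open>m\<close> are forbidden.\<close>

lemma chi_exponent_le:
  assumes "chi_exponent d" "1 \<le> d" "d \<le> CARD('a) - 1" "j \<le> h"
  shows "j * d \<le> m"
  using assms(4)
proof (induction j)
  case (Suc j)
  have d: "d \<le> m"
  proof (rule ccontr)
    assume "\<not> d \<le> m"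
    then show False
      using chi_exponent_residue[OF assms(1), of 1 d] choose_m_small[of 1] h_pos m_pos assms by auto
  qed
  show ?case
  proof (rule ccontr)
    assume *: "\<not> Suc j * d \<le> m"
    have "(m choose Suc j) \<noteq> 0"
      using choose_m_small[OF Suc.prems] by (metis of_nat_0)
    then have "Suc j \<le> m" by (metis binomial_eq_0 not_le)
    moreover have "Suc j * d \<le> CARD('a) - 1" using Suc d q_eq by simp
    ultimately show False
      using chi_exponent_residue[OF assms(1), of "Suc j" "Suc j * d"] choose_m_small[OF Suc.prems] * assms by auto
  qed
qed simp

text \<open>Otherwise \<open>d = B + t\<close> with \<open>B = p ^ (k - 1)\<close> and
  \<open>t \<ge> 1\<close>. Multiplying by a suitable \<open>p ^ i\<close> and reducing modulo
  \<open>q - 1\<close> gives a further exponent \<open>e \<le> m\<close>, and then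
  \<open>j = h + p ^ i\<close> yields the forbidden residue \<open>h * d + e\<close>.\<close>

lemma chi_exponent_large:
  assumes good: "chi_exponent d" and d: "p ^ (k - 1) \<le> d" "d \<le> CARD('a) - 1"
  shows "d = p ^ (k - 1)"
proof (rule ccontr)
  assume ne: "d \<noteq> p ^ (k - 1)"
  define t where "t = d - p ^ (k - 1)"
  define B where "B = p ^ (k - 1)"
  have B: "B \<ge> 1" unfolding B_def using p_gt_1 by simp
  have pk: "p ^ k = p * B" unfolding B_def using k_pos by (simp flip: power_Suc)
  have t: "t \<ge> 1" "d = B + t" using ne d unfolding t_def B_def by auto
  have hd: "h * d \<le> m" using chi_exponent_le[OF good _ d(2), of h] d B unfolding B_def by auto
  have m2: "2 * m + 1 = p * B" using q_eq card_eq pk by simp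
  \<comment> \<open>Otherwise \<open>h * d\<close> would be at least \<open>2 * h * B\<close>,
    exceeding \<open>m = h * B + (B - 1) / 2\<close>.\<close>
  have "t < B"
  proof (rule ccontr)
    assume "\<not> t < B"
    then have "h * (2 * B) \<le> h * d" using t by (intro mult_le_mono2) linarith
    then have "2 * (h * (2 * B)) + 1 \<le> p * B" using m2 hd by linarith
    moreover have "1 * B \<le> h * B" using h_pos by (intro mult_le_mono1)
    moreover have "p * B = 2 * (h * B) + B" using arg_cong[OF p_eq, of "\<lambda>z. z * B"] by simp
    ultimately show False using B by linarith
  qed
  have tk: "t < p ^ k" using \<open>t < B\<close> pk p_gt_1 by (metis less_le_trans mult_le_mono1 nat_mult_1 less_imp_le)
  then obtain i where i: "i < k" "p ^ i * t < p ^ k" "p ^ k \<le> p ^ Suc i * t"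
    using ex_prime_power_multiple[OF p_gt_1 t(1)] by blast
  have i1: "i \<ge> 1"
    using i(3) \<open>t < B\<close> pk p_gt_1 by (cases i) auto
  have ge: "B \<le> p ^ i * t" using i(3) pk p_gt_1 by simp
  define e where "e = p ^ (i - 1) + p ^ i * t"
  have pi: "p ^ i = p * p ^ (i - 1)" using i1 by (simp flip: power_Suc)
  have e_le: "e \<le> CARD('a) - 1"
  proof -
    obtain u where u: "p ^ k = p ^ i * u"
      using i(1) by (metis le_imp_power_dvd less_imp_le dvdE)
    then have "t < u" using i(2) by simp
    then have "p ^ i * t + p ^ i \<le> p ^ k" unfolding u
      by (metis Suc_leI mult_Suc_right mult_le_mono2 add.commute)
    moreover have "p ^ (i - 1) < p ^ i" using pi p_gt_1 by simp
    ultimately show ?thesis unfolding e_def card_eq by linarith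
  qed
  have card1: "[p ^ k = 1] (mod (CARD('a) - 1))"
    using card_ge_5 unfolding card_eq[symmetric] by (simp add: cong_def le_mod_geq)
  \<comment> \<open>The leading digit of \<open>d\<close> wraps around: \<open>p ^ i * B\<close> is
    \<open>p ^ (i - 1) * p ^ k\<close>, and \<open>p ^ k\<close> is 1 modulo
    \<open>q - 1\<close>.\<close>
  have "p ^ i * d = p ^ (i - 1) * p ^ k + p ^ i * t"
    unfolding t pk pi by (simp add: algebra_simps)
  also have "[\<dots> = p ^ (i - 1) * 1 + p ^ i * t] (mod (CARD('a) - 1))"
    by (intro cong_add cong_mult card1 cong_refl)
  finally have cong: "[p ^ i * d = e] (mod (CARD('a) - 1))" unfolding e_def by simp
  have e1: "1 \<le> e" using ge B unfolding e_def by linarith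
  have "chi_exponent e"
    by (rule chi_exponent_cong[OF chi_exponent_mult_power[OF good, of i] cong]) (use e1 t p_gt_1 in auto)
  then have em: "e \<le> m" using chi_exponent_le[of e 1] e_le e1 h_pos by simp
  show False
  proof (rule chi_exponent_residue[OF good])
    show "of_nat (m choose (h + p ^ i)) \<noteq> (0 :: 'a)"
      using choose_m_h_plus_power i1 i by blast
    then have "(m choose (h + p ^ i)) \<noteq> 0" by (metis of_nat_0)
    then show "h + p ^ i \<le> m" by (metis binomial_eq_0 not_le)
    show "[(h + p ^ i) * d = h * d + e] (mod (CARD('a) - 1))"
      unfolding distrib_right by (intro cong_add cong cong_refl)
    show "h * d + e \<le> CARD('a) - 1" using hd em q_eq by simp
    have "h * B + B \<le> h * d + e"
      using t ge unfolding e_def by (intro add_le_mono mult_le_mono2) auto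
    moreover have "p * B = 2 * (h * B) + B" using arg_cong[OF p_eq, of "\<lambda>z. z * B"] by simp
    ultimately show "m < h * d + e" using m2 B by linarith
  qed (use t h_pos in auto)
qed

text \<open>A power of \<open>p\<close> moves the exponent \<open>d\<close> into the range from
  \<open>p ^ (k - 1)\<close> to \<open>q - 1\<close>, where only \<open>p ^ (k - 1)\<close> is
  possible; then that power is cancelled.\<close>

theorem chi_preserving_multiplicative_imp_frob:
  fixes f :: "'a \<Rightarrow> 'a"
  assumes mult: "\<And>x y. f (x * y) = f x * f y" and f01: "f 0 = 0" "f 1 = 1"
    and chi: "\<And>x y. \<chi> (f x - f y) = \<chi> (x - y)"
  obtains l where "l \<le> k - 1" "\<And>x. f x = x ^ p ^ l"
proof -
  obtain d where d: "1 \<le> d" "d \<le> CARD('a) - 1" "\<And>x. f x = x ^ d"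
    using multiplicative_imp_power[OF mult f01] by blast
  have good: "chi_exponent d" unfolding chi_exponent_def using chi by (simp add: d(3) chi_eq_iff)
  obtain i where i: "i < k" "p ^ i * d < p ^ k" "p ^ k \<le> p ^ Suc i * d"
  proof -
    have "d < p ^ k" using d(2) card_eq card_ge_5 by linarith
    then show ?thesis using ex_prime_power_multiple[OF p_gt_1 d(1)] that by blast
  qed
  have pk: "p ^ k = p * p ^ (k - 1)" using k_pos by (simp flip: power_Suc)
  have "p ^ i * d = p ^ (k - 1)"
    by (rule chi_exponent_large[OF chi_exponent_mult_power[OF good]])
       (use i p_gt_1 pk card_eq in auto)
  also have "\<dots> = p ^ i * p ^ (k - 1 - i)" using i(1) by (simp flip: power_add)
  finally have "d = p ^ (k - 1 - i)" using p_gt_1 by simp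
  then show ?thesis using d(3) by (intro that[of "k - 1 - i"]) auto
qed

end

section \<open>Maps preserving positivity of minors\<close>

context one_mod_four_field
begin

lemma S_mult_iff: "x \<in> S \<Longrightarrow> x * y \<in> S \<longleftrightarrow> y \<in> S"
  and S_mult_iff': "x \<in> S \<Longrightarrow> y * x \<in> S \<longleftrightarrow> y \<in> S"
  and N_mult_N: "x \<in> N \<Longrightarrow> y \<in> N \<Longrightarrow> x * y \<in> S"
  and S_mult_N: "x \<in> S \<Longrightarrow> y \<in> N \<Longrightarrow> x * y \<in> N"
  and S_divide: "x \<in> S \<Longrightarrow> y \<in> S \<Longrightarrow> x / y \<in> S"
  and N_divide: "x \<in> N \<Longrightarrow> y \<in> N \<Longrightarrow> x / y \<in> S"
  and S_uminus: "- x \<in> S \<longleftrightarrow> x \<in> S"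
  and one_in_S: "1 \<in> S"
  by (simp_all add: S_chi N_chi chi_mult chi_divide)

lemma S_diff_commute: "x - y \<in> S \<longleftrightarrow> y - x \<in> S"
  by (simp add: S_chi chi_diff_commute)

lemma S_not_N: "x \<in> S \<Longrightarrow> x \<notin> N" and S_neq_0: "x \<in> S \<Longrightarrow> x \<noteq> 0"
  by (auto simp: in_N_iff)

lemma N_neq_0: "x \<in> N \<Longrightarrow> x \<noteq> 0"
  by (auto simp: in_N_iff)

text \<open>If \<open>n + s\<close> were always in \<open>S\<close>, then \<open>s = n ^ 2\<close>
  and \<open>s = 1\<close> would put \<open>n * (1 + n)\<close> and \<open>1 + n\<close> in
  \<open>S\<close>, hence also \<open>n\<close>.\<close>

lemma ex_add_notin_S:
  assumes n: "n \<in> N"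
  obtains s where "s \<in> S" "n + s \<notin> S"
proof -
  have False if all: "\<And>s. s \<in> S \<Longrightarrow> n + s \<in> S"
  proof -
    have "n * (1 + n) \<in> S"
      using all[of "n ^ 2"] square_in_S N_neq_0[OF n] by (simp add: algebra_simps power2_eq_square)
    moreover have "1 + n \<in> S"
      using all[OF one_in_S] by (simp add: add.commute)
    ultimately have "n \<in> S" by (simp add: S_mult_iff')
    then show False using S_not_N n by blast
  qed
  then show ?thesis using that by blast
qed

lemma ex_add_in_N:
  assumes n: "n \<in> N"
  obtains s where "s \<in> S" "n + s \<in> N"
proof -
  obtain s where s: "s \<in> S" "n + s \<notin> S" using ex_add_notin_S[OF n] .
  have "n + s \<noteq> 0"
    using s(1) n S_not_N S_uminus by (metis add_eq_0_iff2)
  then show ?thesis using s by (intro that[of s]) (auto simp: in_N_iff)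
qed

text \<open>Only \<open>x\<close> in \<open>N\<close> is delicate: otherwise \<open>x - s\<close>
  would be in \<open>N\<close> for all \<open>s\<close> in \<open>S\<close>, and
  \<open>s = - (x ^ 2)\<close> and \<open>s = -1\<close> would put both \<open>x * (1 + x)\<close>
  and \<open>1 + x\<close> in \<open>N\<close>.\<close>

lemma ex_minus_square_in_S: obtains b where "x - b ^ 2 \<in> S"
proof -
  have False if x: "x \<in> N" and all: "\<And>b. x - b ^ 2 \<notin> S"
  proof -
    have x0: "x \<noteq> 0" using x N_neq_0 by blast
    have *: "x - s \<in> N" if s: "s \<in> S" for s
    proof -
      obtain b where "s = b ^ 2" using s by (rule SE)
      moreover have "x \<noteq> s" using s x S_not_N by blast
      ultimately show ?thesis using all by (auto simp: in_N_iff)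
    qed
    have "x * (1 + x) \<in> N"
      using *[of "- (x ^ 2)"] square_in_S[OF x0]
      by (simp add: S_uminus algebra_simps power2_eq_square)
    moreover have "1 + x \<in> N"
      using *[of "- 1"] one_in_S by (simp add: S_uminus add.commute)
    ultimately show False using N_mult_N[OF x] S_not_N by blast
  qed
  moreover have "\<exists>b. x - b ^ 2 \<in> S" if "x \<notin> N"
  proof (cases "x = 0")
    case True
    then show ?thesis by (intro exI[of _ 1]) (simp add: S_uminus one_in_S)
  next
    case False
    then show ?thesis using that by (intro exI[of _ 0]) (simp add: in_N_iff)
  qed
  ultimately show ?thesis using that by blast
qed

text \<open>Multiplication by \<open>c' / c\<close>, an element of \<open>S\<close>, carries one set
  onto the other.\<close>

lemma card_neighbours_in_S:
  assumes "\<chi> c = \<chi> c'" "c \<noteq> 0"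
  shows "card {s \<in> S. c - s \<in> S} = card {s \<in> S. c' - s \<in> S}"
proof -
  have c': "c' \<noteq> 0" using assms by auto
  define w where "w = c' / c"
  have w: "w \<in> S" "w \<noteq> 0" "c' = w * c"
    using assms c' chi_cases[of c] by (auto simp: w_def S_chi chi_divide)
  have "bij_betw (\<lambda>s. w * s) {s \<in> S. c - s \<in> S} {s \<in> S. c' - s \<in> S}"
  proof (rule bij_betw_byWitness[of _ "\<lambda>s. s / w"])
    show "(\<lambda>s. w * s) ` {s \<in> S. c - s \<in> S} \<subseteq> {s \<in> S. c' - s \<in> S}"
      using w by (auto simp: S_mult_iff simp flip: right_diff_distrib)
    show "(\<lambda>s. s / w) ` {s \<in> S. c' - s \<in> S} \<subseteq> {s \<in> S. c - s \<in> S}"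
    proof clarify
      fix s assume s: "s \<in> S" "c' - s \<in> S"
      have "c' - s = w * (c - s / w)" using w by (simp add: right_diff_distrib)
      then show "s / w \<in> S \<and> c - s / w \<in> S" using s w by (simp add: S_divide S_mult_iff)
    qed
  qed (use w in auto)
  then show ?thesis by (rule bij_betw_same_card)
qed

end

section \<open>Normalized maps preserving positivity of leading minors up to order 2\<close>

locale minor_preserver = one_mod_four_field_char ty p k
  for ty :: "'a :: finite_field itself" and p k +
  fixes f :: "'a \<Rightarrow> 'a"
  assumes f_1: "f 1 = 1"
    and f_S: "x \<in> S \<Longrightarrow> f x \<in> S"
    and f_minor: "a \<in> S \<Longrightarrow> a * c - b ^ 2 \<in> S \<Longrightarrow> f a * f c - f b ^ 2 \<in> S"
begin

text \<open>Apply \<open>f_minor\<close> to the matrix with rows \<open>(s, s)\<close>,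
  \<open>(s, c)\<close>, of determinant \<open>s * (c - s)\<close>.\<close>

lemma edge:
  assumes "s \<in> S" "c - s \<in> S"
  shows "f c - f s \<in> S"
proof -
  have "s * c - s ^ 2 \<in> S"
    using assms S_mult_iff[of s "c - s"] by (simp add: algebra_simps power2_eq_square)
  then have "f s * (f c - f s) \<in> S"
    using f_minor[OF assms(1), of c s] by (simp add: algebra_simps power2_eq_square)
  then show ?thesis using f_S[OF assms(1)] S_mult_iff by blast
qed

lemma f_neq_0:
  assumes "f 0 = 0" "b \<noteq> 0"
  shows "f b \<noteq> 0"
  using f_minor[OF one_in_S, of 0 b] assms square_in_S by (auto simp: S_uminus)

lemma f_square:
  assumes "\<forall>a\<in>S. \<forall>b. f a * f (b ^ 2 / a) = f b ^ 2"
  shows "f (b ^ 2) = f b ^ 2"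
  using assms one_in_S f_1 by force

lemma f_mult_S:
  assumes norm: "\<forall>a\<in>S. \<forall>b. f a * f (b ^ 2 / a) = f b ^ 2"
    and xy: "x \<in> S" "y \<in> S"
  shows "f (x * y) = f x * f y"
proof -
  have "x * y \<in> S" using xy by (simp add: S_mult_iff)
  then obtain b where b: "x * y = b ^ 2" by (rule SE)
  then have "b ^ 2 / x = y" using S_neq_0[OF xy(1)] by (auto simp: field_simps)
  then show ?thesis using norm xy(1) f_square[OF norm, of b] b by force
qed

section \<open>From injectivity on \<open>S\<close> and preservation of \<open>N\<close> to the
  Frobenius form\<close>

context
  assumes inj: "inj_on f S" and f_N: "\<And>x. x \<in> N \<Longrightarrow> f x \<in> N"
begin

lemma f_image_S: "f ` S = S"
  using inj f_S by (intro endo_inj_surj) auto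

lemma chi_f: "c \<noteq> 0 \<Longrightarrow> \<chi> (f c) = \<chi> c"
  using f_S[of c] f_N[of c] chi_cases[of c] by (auto simp: S_chi N_chi)

text \<open>By \<open>edge\<close>, \<open>f\<close> maps the neighbours of \<open>c\<close> in
  \<open>S\<close> injectively into those of \<open>f c\<close>. Both sets have the same size since
  \<open>\<chi> (f c) = \<chi> c\<close>, so every neighbour of \<open>f c\<close> in
  \<open>S\<close> arises in this way.\<close>

lemma edge_iff:
  assumes "s \<in> S" "c \<noteq> 0"
  shows "f c - f s \<in> S \<longleftrightarrow> c - s \<in> S"
proof -
  have "f ` {s \<in> S. c - s \<in> S} = {s \<in> S. f c - s \<in> S}"
  proof (rule card_subset_eq)
    show "f ` {s \<in> S. c - s \<in> S} \<subseteq> {s \<in> S. f c - s \<in> S}"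
      using edge f_S by auto
    have "card (f ` {s \<in> S. c - s \<in> S}) = card {s \<in> S. c - s \<in> S}"
      using inj by (intro card_image) (auto intro: inj_on_subset)
    then show "card (f ` {s \<in> S. c - s \<in> S}) = card {s \<in> S. f c - s \<in> S}"
      using card_neighbours_in_S[of c "f c"] chi_f[OF assms(2)] assms(2) by simp
  qed simp
  then have "f s \<in> f ` {s \<in> S. c - s \<in> S}" if "f c - f s \<in> S"
    using that f_S[OF assms(1)] by auto
  then have "c - s \<in> S" if "f c - f s \<in> S"
    using that inj assms(1) by (auto dest: inj_onD)
  then show ?thesis using edge[OF assms(1)] by blast
qed

lemma same_neighbours_imp_eq:
  assumes "x \<in> N" "y \<in> N" "\<And>s. s \<in> S \<Longrightarrow> x - f s \<in> S \<longleftrightarrow> y - f s \<in> S"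
  shows "x = y"
proof (rule twin_N[OF assms(1,2)])
  fix s assume "s \<in> S"
  then obtain s' where s': "s' \<in> S" "s = f s'" using f_image_S by blast
  have "x - s \<noteq> 0" "y - s \<noteq> 0" using \<open>s \<in> S\<close> assms(1,2) S_not_N by auto
  then show "\<chi> (x - s) = \<chi> (y - s)"
    using assms(3)[OF s'(1)] chi_cases[of "x - s"] chi_cases[of "y - s"] by (auto simp: S_chi s')
qed

lemma inj_on_N: "inj_on f N"
proof (rule inj_onI)
  fix x y assume xy: "x \<in> N" "y \<in> N" "f x = f y"
  show "x = y"
  proof (rule twin_N[OF xy(1,2)])
    fix s assume s: "s \<in> S"
    then have "x - s \<in> S \<longleftrightarrow> y - s \<in> S"
      using edge_iff[of s x] edge_iff[of s y] xy N_neq_0 by simp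
    moreover have "x - s \<noteq> 0" "y - s \<noteq> 0" using s xy(1,2) S_not_N by auto
    ultimately show "\<chi> (x - s) = \<chi> (y - s)"
      using chi_cases[of "x - s"] chi_cases[of "y - s"] by (auto simp: S_chi)
  qed
qed

lemma inj_f:
  assumes f_0: "f 0 = 0"
  shows "inj f"
proof (rule injI)
  fix x y assume eq: "f x = f y"
  have 0: "f z = 0 \<longleftrightarrow> z = 0" for z using f_neq_0[OF f_0] f_0 by blast
  consider "x = 0 \<or> y = 0" | "x \<in> S" "y \<in> S" | "x \<in> N" "y \<in> N"
    | "x \<in> S" "y \<in> N" | "x \<in> N" "y \<in> S"
    by (auto simp: in_N_iff)
  then show "x = y"
  proof cases
    case 1
    then show ?thesis using eq 0 f_0 by metis
  next
    case 2
    then show ?thesis using inj eq by (auto dest: inj_onD)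
  next
    case 3
    then show ?thesis using inj_on_N eq by (auto dest: inj_onD)
  next
    case 4
    then show ?thesis using eq f_S f_N S_not_N by metis
  next
    case 5
    then show ?thesis using eq f_S f_N S_not_N by metis
  qed
qed

text \<open>On \<open>S\<close> this is \<open>f_mult_S\<close>. For \<open>a\<close> in
  \<open>S\<close> and \<open>c\<close> in \<open>N\<close>, rescaling by \<open>a\<close> shows
  that \<open>f (a * c)\<close> and \<open>f a * f c\<close> have the same neighbours in
  \<open>S\<close>. Two factors in \<open>N\<close> reduce to this by
  \<open>c * d = (c / d) * d ^ 2\<close>.\<close>

lemma f_mult:
  assumes f_0: "f 0 = 0" and norm: "\<forall>a\<in>S. \<forall>b. f a * f (b ^ 2 / a) = f b ^ 2"
  shows "f (x * y) = f x * f y"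
proof -
  note sq = f_square[OF norm] and SS = f_mult_S[OF norm]
  have SN: "f (a * c) = f a * f c" if "a \<in> S" "c \<in> N" for a c
  proof (rule same_neighbours_imp_eq)
    show "f (a * c) \<in> N" "f a * f c \<in> N"
      using that by (simp_all add: f_N f_S S_mult_N)
    fix s assume s: "s \<in> S"
    have a0: "a \<noteq> 0" using that S_neq_0 by blast
    have sa: "s / a \<in> S" using s that by (simp add: S_divide)
    have fs: "f s = f a * f (s / a)" using SS[OF that(1) sa] a0 by simp
    have "f (a * c) - f s \<in> S \<longleftrightarrow> a * c - s \<in> S"
      using a0 that N_neq_0 by (intro edge_iff s) auto
    also have "a * c - s = a * (c - s / a)" using a0 by (simp add: field_simps)
    also have "\<dots> \<in> S \<longleftrightarrow> c - s / a \<in> S" using that by (simp add: S_mult_iff)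
    also have "\<dots> \<longleftrightarrow> f c - f (s / a) \<in> S"
      using edge_iff[OF sa, of c] that N_neq_0 by auto
    also have "\<dots> \<longleftrightarrow> f a * (f c - f (s / a)) \<in> S"
      using that by (simp add: S_mult_iff f_S)
    also have "f a * (f c - f (s / a)) = f a * f c - f s"
      unfolding fs by (simp add: algebra_simps)
    finally show "f (a * c) - f s \<in> S \<longleftrightarrow> f a * f c - f s \<in> S" .
  qed
  have NN: "f (c * d) = f c * f d" if "c \<in> N" "d \<in> N" for c d
  proof -
    have d0: "d \<noteq> 0" using that N_neq_0 by blast
    have cd: "c / d \<in> S" using that by (simp add: N_divide)
    have "f (c * d) = f (c / d * d ^ 2)" using d0 by (simp add: power2_eq_square)
    also have "\<dots> = f (c / d) * f d * f d"
      by (subst SS[OF cd square_in_S[OF d0]]) (simp only: sq, simp add: power2_eq_square mult.assoc)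
    also have "f (c / d) * f d = f c" using SN[OF cd that(2)] d0 by simp
    finally show ?thesis .
  qed
  consider "x = 0 \<or> y = 0" | "x \<in> S" "y \<in> S" | "x \<in> N" "y \<in> N"
    | "x \<in> S" "y \<in> N" | "x \<in> N" "y \<in> S"
    by (auto simp: in_N_iff)
  then show ?thesis
    by cases (use f_0 SS SN[of x y] SN[of y x] NN in \<open>auto simp: mult.commute\<close>)
qed

text \<open>Multiplicativity gives \<open>f x - f y = f y * (f (x / y) - 1)\<close>, so only
  differences with 1 matter, and \<open>edge_iff\<close> covers these.\<close>

lemma imp_frob:
  assumes f_0: "f 0 = 0" and norm: "\<forall>a\<in>S. \<forall>b. f a * f (b ^ 2 / a) = f b ^ 2"
  obtains l where "l \<le> k - 1" "\<And>x. f x = x ^ p ^ l"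
proof (rule chi_preserving_multiplicative_imp_frob)
  show mult: "f (x * y) = f x * f y" for x y by (rule f_mult[OF f_0 norm])
  show "f 0 = 0" "f 1 = 1" by (rule f_0, rule f_1)
  have chi: "\<chi> (f x) = \<chi> x" for x using chi_f f_0 by (cases "x = 0") auto
  show "\<chi> (f x - f y) = \<chi> (x - y)" for x y
  proof (cases "y = 0")
    case False
    have 1: "\<chi> (f z - 1) = \<chi> (z - 1)" for z
    proof (cases "z = 0")
      case False
      have "f z - 1 \<in> S \<longleftrightarrow> z - 1 \<in> S"
        using edge_iff[OF one_in_S False] f_1 by simp
      moreover have "f z = 1 \<longleftrightarrow> z = 1"
        using inj_f[OF f_0] f_1 by (metis injD)
      ultimately show ?thesis
        using chi_cases[of "f z - 1"] chi_cases[of "z - 1"] by (auto simp: S_chi)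
    qed (simp add: f_0)
    have "x - y = y * (x / y - 1)" using False by (simp add: field_simps)
    moreover have "f x - f y = f y * (f (x / y) - 1)"
      using False mult[of y "x / y"] by (simp add: algebra_simps)
    ultimately show ?thesis by (simp add: chi_mult chi 1)
  qed (simp add: f_0 chi)
qed (use that in blast)

end

end

section \<open>Maps that also preserve positivity of minors of order 3\<close>

locale minor3_preserver = minor_preserver ty p k f
  for ty :: "'a :: finite_field itself" and p k f +
  assumes f_minor3: "a \<in> S \<Longrightarrow> a * c - b ^ 2 \<in> S \<Longrightarrow>
      a * (c * g - e ^ 2) - b * (b * g - d * e) + d * (b * e - c * d) \<in> S \<Longrightarrow>
      f a * (f c * f g - f e ^ 2) - f b * (f b * f g - f d * f e) + f d * (f b * f e - f c * f d) \<in> S"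
begin

text \<open>The matrix with rows \<open>(1, b, b)\<close>, \<open>(b, x, x)\<close>,
  \<open>(b, x, y)\<close> has determinant \<open>(x - b ^ 2) * (y - x)\<close>. Unlike in
  \<open>edge\<close>, no endpoint has to lie in \<open>S\<close>.\<close>

lemma edge_all:
  assumes "y - x \<in> S"
  shows "f y - f x \<in> S"
proof -
  obtain b where b: "x - b ^ 2 \<in> S" by (rule ex_minus_square_in_S)
  have "1 * (x * y - x ^ 2) - b * (b * y - b * x) + b * (b * x - x * b) = (x - b ^ 2) * (y - x)"
    by (simp add: algebra_simps power2_eq_square)
  then have "1 * (x * y - x ^ 2) - b * (b * y - b * x) + b * (b * x - x * b) \<in> S"
    using b assms by (simp add: S_mult_iff)
  then have "f 1 * (f x * f y - f x ^ 2) - f b * (f b * f y - f b * f x) + f b * (f b * f x - f x * f b) \<in> S"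
    using b one_in_S by (intro f_minor3) auto
  also have "f 1 * (f x * f y - f x ^ 2) - f b * (f b * f y - f b * f x) + f b * (f b * f x - f x * f b)
      = (f x - f b ^ 2) * (f y - f x)"
    by (simp add: algebra_simps power2_eq_square f_1)
  finally show ?thesis
    using f_minor[OF one_in_S, of x b] b f_1 by (simp add: S_mult_iff)
qed

text \<open>If \<open>f x = f y\<close>, then \<open>f\<close> maps the symmetric matrix with rows \<open>(x, b, y)\<close>, \<open>(b, c, b)\<close>,
  \<open>(y, b, x)\<close>, whose determinant is \<open>(x - y) * (c * (x + y) - 2 * b\<^sup>2)\<close>, to a singular one.\<close>

lemma f_neq_on_S:
  assumes x: "x \<in> S" and ne: "x \<noteq> y"
  shows "f x \<noteq> f y"
proof (cases "x - y \<in> S")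
  case True
  then show ?thesis using edge_all[of x y] by auto
next
  case False
  then have xy: "x - y \<in> N" using ne by (auto simp: in_N_iff)
  have x0: "x \<noteq> 0" using x S_neq_0 by blast
  \<comment> \<open>As \<open>x - y\<close> is in \<open>N\<close>, the other factor of the
    determinant must be in \<open>N\<close> too.\<close>
  have "\<exists>b c. x * c - b ^ 2 \<in> S \<and> c * (x + y) - 2 * b ^ 2 \<in> N"
  proof -
    consider "x + y \<in> N" | "x + y = 0" | "x + y \<in> S" by (auto simp: in_N_iff)
    then show ?thesis
    proof cases
      case 1
      then show ?thesis using x x0
        by (intro exI[of _ 0] exI[of _ x]) (auto simp: S_mult_iff S_mult_N)
    next
      case 2
      then have "x - y = 2 * x" by (simp add: algebra_simps add_eq_0_iff)
      then have "\<chi> (x - y) = \<chi> 2 * \<chi> x" by (metis chi_mult)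
      then have "2 \<in> N" using xy x by (simp add: N_chi S_chi)
      then show ?thesis using 2 x0 one_in_S
        by (intro exI[of _ 1] exI[of _ "2 / x"]) (auto simp: N_chi)
    next
      case 3
      have "y - x \<in> N" using xy by (simp add: N_chi chi_diff_commute)
      then obtain u where u: "u \<in> S" "y - x + u \<in> N" by (rule ex_add_in_N)
      have nz: "x + y \<noteq> 0" using 3 S_neq_0 by blast
      \<comment> \<open>With \<open>b = 1\<close>, this \<open>c\<close> solves
        \<open>x * c - 1 = u / (x + y)\<close>; the other factor becomes
        \<open>(y - x + u) / x\<close>.\<close>
      define c where "c = (1 + u / (x + y)) / x"
      have "x * c - 1 ^ 2 = u / (x + y)" using x0 by (simp add: c_def)
      moreover have "c * (x + y) - 2 * 1 ^ 2 = (y - x + u) / x"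
      proof -
        have "c * (x + y) = (1 + u / (x + y)) * (x + y) / x" by (simp add: c_def)
        also have "(1 + u / (x + y)) * (x + y) = x + y + u" using nz by (simp add: distrib_right)
        finally show ?thesis using x0 by (simp add: field_simps)
      qed
      moreover have "u / (x + y) \<in> S" "(y - x + u) / x \<in> N"
        using u 3 x by (simp_all add: S_divide N_chi S_chi chi_divide)
      ultimately show ?thesis by metis
    qed
  qed
  then obtain b c where bc: "x * c - b ^ 2 \<in> S" "c * (x + y) - 2 * b ^ 2 \<in> N" by blast
  have "x * (c * x - b ^ 2) - b * (b * x - y * b) + y * (b * b - c * y) =
      (x - y) * (c * (x + y) - 2 * b ^ 2)"
    by (simp add: algebra_simps power2_eq_square)
  then have "x * (c * x - b ^ 2) - b * (b * x - y * b) + y * (b * b - c * y) \<in> S"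
    using N_mult_N[OF xy bc(2)] by simp
  then have *: "f x * (f c * f x - f b ^ 2) - f b * (f b * f x - f y * f b) + f y * (f b * f b - f c * f y) \<in> S"
    using x bc(1) by (intro f_minor3)
  show ?thesis
  proof
    assume "f x = f y"
    then have "0 \<in> S" using * by (simp add: algebra_simps power2_eq_square)
    then show False by simp
  qed
qed

lemma inj_on_S: "inj_on f S"
  using f_neq_on_S by (metis inj_onI)

lemma f_notin_S:
  assumes "x \<notin> S"
  shows "f x \<notin> S"
proof
  assume "f x \<in> S"
  moreover have "f ` S = S" using inj_on_S f_S by (intro endo_inj_surj) auto
  ultimately obtain s where "s \<in> S" "f s = f x" by (metis imageE)
  then show False using f_neq_on_S assms by metis
qed

lemma f_zero: "f 0 = 0"
proof (rule ccontr)
  assume "f 0 \<noteq> 0"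
  then have n: "- f 0 \<in> N" using f_notin_S[of 0] by (simp add: in_N_iff S_uminus)
  obtain s where s: "s \<in> S" "- f 0 + s \<notin> S" using n by (rule ex_add_notin_S)
  have "f ` S = S" using inj_on_S f_S by (intro endo_inj_surj) auto
  then obtain s' where s': "s' \<in> S" "s = f s'" using s by blast
  then have "f s' - f 0 \<in> S" by (intro edge_all) simp
  then show False using s s' by simp
qed

lemma f_in_N: "x \<in> N \<Longrightarrow> f x \<in> N"
  using f_neq_0[OF f_zero] f_notin_S by (auto simp: in_N_iff)

text \<open>Since \<open>a * c - b ^ 2 = a * (c - w)\<close>, \<open>f\<close> maps the
  \<open>m\<close> neighbours of \<open>w\<close> injectively into those of \<open>v\<close> and of
  \<open>f w\<close>. Both neighbourhoods have \<open>m\<close> elements, so they coincide and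
  \<open>v = f w\<close>.\<close>

lemma norm_eq: "\<forall>a\<in>S. \<forall>b. f a * f (b ^ 2 / a) = f b ^ 2"
proof (intro ballI allI)
  fix a b assume a: "a \<in> S"
  define w where "w = b ^ 2 / a"
  define v where "v = f b ^ 2 / f a"
  have a0: "a \<noteq> 0" "f a \<noteq> 0" using a f_S S_neq_0 by blast+
  have inj: "inj f" by (rule inj_f[OF inj_on_S f_in_N f_zero])
  have card: "card {y. y - z \<in> S} = m" for z
  proof -
    have "bij_betw (\<lambda>y. y + z) S {y. y - z \<in> S}"
      by (rule bij_betw_byWitness[of _ "\<lambda>y. y - z"]) auto
    then show ?thesis using bij_betw_same_card card_S by metis
  qed
  have "f c - v \<in> S" if c: "c - w \<in> S" for c
  proof -
    have "a * c - b ^ 2 = a * (c - w)" using a0 by (simp add: w_def field_simps)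
    then have "f a * f c - f b ^ 2 \<in> S" using c a by (intro f_minor) (auto simp: S_mult_iff)
    also have "f a * f c - f b ^ 2 = f a * (f c - v)" using a0 by (simp add: v_def field_simps)
    finally show ?thesis using a f_S by (simp add: S_mult_iff)
  qed
  then have "f ` {c. c - w \<in> S} \<subseteq> {y. y - v \<in> S}" "f ` {c. c - w \<in> S} \<subseteq> {y. y - f w \<in> S}"
    using edge_all by auto
  moreover have "card (f ` {c. c - w \<in> S}) = m"
    using inj by (subst card_image) (auto simp: card intro: inj_on_subset)
  ultimately have "{y. y - v \<in> S} = {y. y - f w \<in> S}"
    using card card_subset_eq[of "{y. y - v \<in> S}"] card_subset_eq[of "{y. y - f w \<in> S}"]
    by (metis finite)
  then have "v = f w" by (intro twin_UNIV) (auto simp: chi_eq_1_iff)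
  then show "f a * f (b ^ 2 / a) = f b ^ 2" using a0 by (simp add: v_def w_def field_simps)
qed

theorem eq_frob:
  obtains l where "l \<le> k - 1" "\<And>x. f x = x ^ p ^ l"
  using imp_frob[OF inj_on_S f_in_N f_zero norm_eq] by blast

end

section \<open>Fields of square order\<close>

context one_mod_four_field
begin

text \<open>In a Paley graph of order \<open>r\<^sup>2\<close>, a clique \<open>C\<close> of size \<open>r\<close> meets the neighbourhood of every
  outside vertex equally often: with \<open>T v = (\<Sum>x\<in>C. \<chi> (v - x))\<close>, the first two moments of \<open>T\<close>
  force \<open>(\<Sum>v\<in>-C. (T v + 1)\<^sup>2) = 0\<close>.\<close>

lemma clique_regular:
  assumes card: "CARD('a) = r ^ 2" "card C = r"
    and clique: "\<And>x y. x \<in> C \<Longrightarrow> y \<in> C \<Longrightarrow> x \<noteq> y \<Longrightarrow> x - y \<in> S"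
    and v: "v \<notin> C"
  shows "(\<Sum>x\<in>C. \<chi> (v - x)) = -1"
proof -
  define T where "T v = (\<Sum>x\<in>C. \<chi> (v - x))" for v
  have r: "r \<ge> 1" using card card_ge_5 by (cases r) auto
  have T_C: "T v = int r - 1" if "v \<in> C" for v
  proof -
    have "T v = (\<Sum>x\<in>C - {v}. \<chi> (v - x))"
      unfolding T_def by (rule sum.mono_neutral_right) auto
    also have "\<dots> = (\<Sum>x\<in>C - {v}. 1)"
      using clique that by (intro sum.cong) (auto simp: S_chi)
    finally show ?thesis using that card r by (simp add: of_nat_diff)
  qed
  have "(\<Sum>v\<in>UNIV. T v) = (\<Sum>x\<in>C. \<Sum>v\<in>UNIV. \<chi> (v - x))"
    unfolding T_def by (rule sum.swap)
  also have "\<dots> = (\<Sum>x\<in>C. 0)"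
  proof (rule sum.cong)
    fix x :: 'a
    have "(\<Sum>v\<in>UNIV. \<chi> (v - x)) = (\<Sum>v\<in>UNIV. \<chi> v)"
      by (rule sum.reindex_bij_witness[of _ "\<lambda>v. v + x" "\<lambda>v. v - x"]) auto
    then show "(\<Sum>v\<in>UNIV. \<chi> (v - x)) = 0" by (simp add: sum_chi)
  qed simp
  finally have sum_T: "(\<Sum>v\<in>UNIV. T v) = 0" by simp
  have sq: "(\<Sum>v\<in>UNIV. \<chi> (v - x) * \<chi> (v - y)) = (if x = y then int r ^ 2 - 1 else -1)" for x y
  proof (cases "x = y")
    case True
    have "(\<Sum>v\<in>UNIV. \<chi> (v - x) * \<chi> (v - x)) = (\<Sum>v\<in>UNIV - {x}. \<chi> (v - x) * \<chi> (v - x))"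
      by (rule sum.mono_neutral_right) auto
    also have "\<dots> = (\<Sum>v\<in>UNIV - {x}. 1)"
    proof (rule sum.cong)
      show "\<chi> (v - x) * \<chi> (v - x) = 1" if "v \<in> UNIV - {x}" for v
        using chi_cases[of "v - x"] that by auto
    qed simp
    finally show ?thesis using card r True by (simp add: card_Diff_subset of_nat_diff)
  qed (simp add: sum_chi_mult_diff)
  have "(\<Sum>v\<in>UNIV. T v ^ 2) = (\<Sum>x\<in>C. \<Sum>y\<in>C. \<Sum>v\<in>UNIV. \<chi> (v - x) * \<chi> (v - y))"
    unfolding T_def power2_eq_square sum_product
    by (subst sum.swap) (intro sum.cong refl sum.swap)
  also have "\<dots> = (\<Sum>x\<in>C. \<Sum>y\<in>C. (if y = x then int r ^ 2 else 0) - 1)"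
    unfolding sq by (intro sum.cong) auto
  also have "\<dots> = int r * (int r ^ 2 - int r)"
    using card by (simp add: sum_subtractf)
  finally have sum_T2: "(\<Sum>v\<in>UNIV. T v ^ 2) = int r * (int r ^ 2 - int r)" .
  have split: "(\<Sum>v\<in>UNIV. g v) = (\<Sum>v\<in>C. g v) + (\<Sum>v\<in>-C. g v)" for g :: "'a \<Rightarrow> int"
    by (metis Compl_eq_Diff_UNIV add.commute finite subset_UNIV sum.subset_diff)
  have out: "(\<Sum>v\<in>-C. T v) = - (int r * (int r - 1))"
    using split[of T] sum_T T_C card by simp
  have out2: "(\<Sum>v\<in>-C. T v ^ 2) = int r * (int r ^ 2 - int r) - int r * (int r - 1) ^ 2"
    using split[of "\<lambda>v. T v ^ 2"] sum_T2 T_C card by simp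
  have "int (card (- C)) = int r ^ 2 - int r"
    using split[of "\<lambda>_. 1"] card by simp
  then have "(\<Sum>v\<in>-C. (T v + 1) ^ 2) = 0"
    using out out2
    by (simp add: power2_sum sum.distrib flip: sum_distrib_left) (simp add: algebra_simps power2_eq_square)
  then have "(T v + 1) ^ 2 = 0" using v
    by (subst (asm) sum_nonneg_eq_0_iff) auto
  then show ?thesis by (simp add: T_def)
qed

end

section \<open>The subfield \<open>R\<close> of order \<open>r\<close> and the images of its
  lines\<close>

locale square_minor_preserver = minor_preserver ty p k f
  for ty :: "'a :: finite_field itself" and p k f +
  fixes r :: nat
  assumes card_square: "CARD('a) = r ^ 2"
begin

definition R :: "'a set" where "R = {x. x ^ r = x}"

lemma r_ge_3: "r \<ge> 3"
proof (rule ccontr)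
  assume "\<not> r \<ge> 3"
  then have "r ^ 2 \<le> 2 ^ 2" by (intro power_mono) auto
  then show False using card_square card_ge_5 by simp
qed

lemma R_iff: "x \<in> R \<longleftrightarrow> x = 0 \<or> x ^ (r - 1) = 1"
proof -
  have "x ^ r = x * x ^ (r - 1)" using r_ge_3 by (simp flip: power_Suc)
  then show ?thesis unfolding R_def by auto
qed

lemma R_0: "0 \<in> R" and R_1: "1 \<in> R"
  by (simp_all add: R_iff)

lemma R_diff: "x \<in> R \<Longrightarrow> y \<in> R \<Longrightarrow> x - y \<in> R"
proof -
  have "r dvd p ^ k" using card_square card_eq by (metis dvd_triv_left power2_eq_square)
  then obtain j where "r = p ^ j" using prime_p divides_primepow_nat by blast
  then show "x \<in> R \<Longrightarrow> y \<in> R \<Longrightarrow> x - y \<in> R" unfolding R_def by (simp add: frob_diff)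
qed

text \<open>Since \<open>m = (r - 1) * ((r + 1) / 2)\<close>, \<open>x ^ (r - 1) = 1\<close> implies
  \<open>x ^ m = 1\<close>.\<close>

lemma R_subset_S: "x \<in> R \<Longrightarrow> x \<noteq> 0 \<Longrightarrow> x \<in> S"
proof -
  assume x: "x \<in> R" "x \<noteq> 0"
  have "odd r" using card_square q_eq by (metis even_power even_Suc even_mult_iff even_numeral Suc_eq_plus1 pos2)
  then obtain b where b: "r = 2 * b + 1" by (rule oddE)
  have "m = (r - 1) * (b + 1)"
    using card_square q_eq unfolding b by (simp add: power2_eq_square algebra_simps)
  then have "x ^ m = (x ^ (r - 1)) ^ (b + 1)" by (simp only: power_mult)
  then show "x \<in> S" using x by (simp add: S_eq R_iff)
qed

text \<open>The upper bound counts roots. For the lower bound, the norm \<open>x ^ (r + 1)\<close>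
  maps the \<open>r ^ 2 - 1\<close> nonzero elements into \<open>R - {0}\<close> with fibres of size
  at most \<open>r + 1\<close>.\<close>

lemma card_R: "card R = r"
proof (rule antisym)
  have "card R \<le> card (insert 0 {x::'a. x ^ (r - 1) = 1})"
    by (intro card_mono) (auto simp: R_iff)
  also have "\<dots> \<le> Suc (card {x::'a. x ^ (r - 1) = 1})" by (rule card_insert_le_m1) auto
  also have "\<dots> \<le> r" using card_power_eq_le[of "r - 1" "1 :: 'a"] r_ge_3 by auto
  finally show "card R \<le> r" .
  have "card (UNIV - {0 :: 'a}) \<le> (r + 1) * card (R - {0})"
  proof (rule card_le_fibres[where f = "\<lambda>x. x ^ (r + 1)"])
    show "(\<lambda>x. x ^ (r + 1)) ` (UNIV - {0}) \<subseteq> R - {0}"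
    proof (rule image_subsetI)
      fix x :: 'a assume "x \<in> UNIV - {0}"
      then have "x \<noteq> 0" by simp
      have "(x ^ (r + 1)) ^ r = x ^ (r ^ 2) * x ^ r"
        by (simp add: power2_eq_square algebra_simps flip: power_mult power_add)
      also have "x ^ (r ^ 2) = x"
        using finite_field_power_card_eq_same[of x] by (simp add: card_square)
      finally have "(x ^ (r + 1)) ^ r = x ^ (r + 1)" by simp
      then show "x ^ (r + 1) \<in> R - {0}" using \<open>x \<noteq> 0\<close> by (simp add: R_def)
    qed
    show "card {x \<in> UNIV - {0}. x ^ (r + 1) = y} \<le> r + 1" for y :: 'a
      by (rule order.trans[OF card_mono card_power_eq_le[of "r + 1" y]]) auto
  qed auto
  then have "r ^ 2 - 1 \<le> (r + 1) * (card R - 1)"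
    using R_0 by (simp add: card_Diff_subset card_square)
  moreover have "r ^ 2 - 1 = (r + 1) * (r - 1)"
    by (simp add: power2_eq_square algebra_simps)
  ultimately have "(r + 1) * (r - 1) \<le> (r + 1) * (card R - 1)" by metis
  then have "r - 1 \<le> card R - 1" unfolding mult_le_cancel1 by simp
  moreover have "card R > 0" using R_0 by (auto simp: card_gt_0_iff)
  ultimately show "r \<le> card R" by linarith
qed

text \<open>At least one of \<open>s * x\<close>, \<open>s * y\<close> is nonzero and hence in
  \<open>S\<close>, as \<open>edge\<close> demands.\<close>

lemma image_clique:
  assumes s: "s \<in> S" and xy: "x \<in> R" "y \<in> R" "x \<noteq> y"
  shows "f (s * x) - f (s * y) \<in> S"
proof -
  have *: "s * x - s * y \<in> S" "s * y - s * x \<in> S"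
    using R_subset_S[OF R_diff[OF xy(1,2)]] R_subset_S[OF R_diff[OF xy(2,1)]] xy s
    by (auto simp: S_mult_iff simp flip: right_diff_distrib)
  show ?thesis
  proof (cases "y = 0")
    case True
    then have "s * x \<in> S" using R_subset_S xy s by (auto simp: S_mult_iff)
    then show ?thesis using edge[of "s * x" "s * y"] * S_diff_commute by blast
  next
    case False
    then have "s * y \<in> S" using R_subset_S xy s by (auto simp: S_mult_iff)
    then show ?thesis using edge[of "s * y" "s * x"] * by blast
  qed
qed

lemma inj_on_line:
  assumes s: "s \<in> S"
  shows "inj_on (\<lambda>x. f (s * x)) R"
  using image_clique[OF s] by (intro inj_onI) (metis diff_self zero_notin_S)

lemma sum_image_line:
  assumes s: "s \<in> S" and v: "\<And>x. x \<in> R \<Longrightarrow> v \<noteq> f (s * x)"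
  shows "(\<Sum>x\<in>R. \<chi> (v - f (s * x))) = -1"
proof -
  have "(\<Sum>x\<in>(\<lambda>x. f (s * x)) ` R. \<chi> (v - x)) = -1"
  proof (rule clique_regular[OF card_square])
    show "card ((\<lambda>x. f (s * x)) ` R) = r"
      using inj_on_line[OF s] card_R by (simp add: card_image)
  qed (use image_clique[OF s] v in auto)
  then show ?thesis using inj_on_line[OF s] by (simp add: sum.reindex)
qed

lemma sum_line:
  assumes s: "s \<in> S" and v: "v \<in> N"
  shows "(\<Sum>x\<in>R. \<chi> (v - s * x)) = -1"
proof -
  have inj: "inj_on (\<lambda>x. s * x) R" using S_neq_0[OF s] by (intro inj_onI) simp
  have "(\<Sum>x\<in>(\<lambda>x. s * x) ` R. \<chi> (v - x)) = -1"
  proof (rule clique_regular[OF card_square])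
    show "card ((\<lambda>x. s * x) ` R) = r" using inj card_R by (simp add: card_image)
    show "v \<notin> (\<lambda>x. s * x) ` R"
    proof
      assume "v \<in> (\<lambda>x. s * x) ` R"
      then obtain x where x: "x \<in> R" "v = s * x" by blast
      then have "x \<noteq> 0" using N_neq_0[OF v] by auto
      then have "v \<in> S" using x R_subset_S s by (simp add: S_mult_iff)
      then show False using v S_not_N by blast
    qed
    fix x y assume "x \<in> (\<lambda>x. s * x) ` R" "y \<in> (\<lambda>x. s * x) ` R" "x \<noteq> y"
    then obtain x' y' where "x' \<in> R" "y' \<in> R" "x' \<noteq> y'" "x = s * x'" "y = s * y'" by blast
    then show "x - y \<in> S"
      using R_subset_S[OF R_diff[of x' y']] s by (auto simp: S_mult_iff simp flip: right_diff_distrib)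
  qed
  then show ?thesis using inj by (simp add: sum.reindex)
qed

text \<open>A vertex outside the image has character sum -1 over it, but adjacency to all vertices
  except one makes the sum at least \<open>r - 2 > 0\<close>.\<close>

lemma mem_image_line:
  assumes s: "s \<in> S" and x0: "x0 \<in> R"
    and adj: "\<And>x. x \<in> R \<Longrightarrow> x \<noteq> x0 \<Longrightarrow> f (s * x) - v \<in> S"
  shows "v = f (s * x0)"
proof (rule ccontr)
  assume ne: "v \<noteq> f (s * x0)"
  have "v \<noteq> f (s * x)" if "x \<in> R" for x
    using adj[OF that] ne by (cases "x = x0") auto
  then have "-1 = (\<Sum>x\<in>R. \<chi> (v - f (s * x)))" using sum_image_line[OF s] by simp
  also have "\<dots> = \<chi> (v - f (s * x0)) + (\<Sum>x\<in>R - {x0}. \<chi> (v - f (s * x)))"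
    using x0 by (simp add: sum.remove)
  also have "(\<Sum>x\<in>R - {x0}. \<chi> (v - f (s * x))) = (\<Sum>x\<in>R - {x0}. 1)"
    using adj by (intro sum.cong) (auto simp: S_chi chi_diff_commute)
  also have "\<dots> = int r - 1" using x0 card_R r_ge_3 by (simp add: of_nat_diff)
  finally show False using chi_abs_le(2)[of "v - f (s * x0)"] r_ge_3 by linarith
qed

lemma f_zero: "f 0 = 0"
  using mem_image_line[OF one_in_S R_0, of 0] f_S R_subset_S by simp

text \<open>For \<open>x\<close> in \<open>R\<close> other than 1,
  \<open>a * (c * x) - b ^ 2 = b ^ 2 * (x - 1)\<close> is in \<open>S\<close>. So \<open>v\<close>
  is adjacent to the image of the line \<open>c R\<close> except possibly at \<open>f c\<close>, and
  \<open>mem_image_line\<close> gives \<open>v = f c\<close>.\<close>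

lemma norm_eq: "\<forall>a\<in>S. \<forall>b. f a * f (b ^ 2 / a) = f b ^ 2"
proof (intro ballI allI)
  fix a b assume a: "a \<in> S"
  show "f a * f (b ^ 2 / a) = f b ^ 2"
  proof (cases "b = 0")
    case False
    define c where "c = b ^ 2 / a"
    define v where "v = f b ^ 2 / f a"
    have a0: "a \<noteq> 0" "f a \<noteq> 0" using a f_S S_neq_0 by blast+
    have c: "c \<in> S" using a False by (simp add: c_def S_divide square_in_S)
    have "v = f (c * 1)"
    proof (rule mem_image_line[OF c R_1])
      fix x assume x: "x \<in> R" "x \<noteq> 1"
      have "a * (c * x) - b ^ 2 = b ^ 2 * (x - 1)" using a0 by (simp add: c_def field_simps)
      also have "\<dots> \<in> S" using R_subset_S[OF R_diff[OF x(1) R_1]] x(2) square_in_S[OF False]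
        by (simp add: S_mult_iff)
      finally have "f a * f (c * x) - f b ^ 2 \<in> S" by (rule f_minor[OF a])
      also have "f a * f (c * x) - f b ^ 2 = f a * (f (c * x) - v)"
        using a0 by (simp add: v_def field_simps)
      finally show "f (c * x) - v \<in> S" using a f_S by (simp add: S_mult_iff)
    qed
    then show ?thesis using a0 by (simp add: v_def c_def field_simps)
  qed (simp add: f_zero)
qed

lemma f_divide_S:
  assumes "x \<in> S" "y \<in> S"
  shows "f (x / y) = f x / f y"
proof -
  have "f (x / y) * f y = f x"
    using f_mult_S[OF norm_eq S_divide[OF assms] assms(2)] S_neq_0[OF assms(2)] by simp
  then show ?thesis using S_neq_0[OF f_S[OF assms(2)]] by (simp add: field_simps)
qed

text \<open>The kernel of \<open>f\<close> on \<open>S\<close> has odd order since it does not contain \<open>-1\<close>.\<close>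

lemma kernel_square_root:
  assumes "z \<in> S" "f z = 1"
  obtains y where "y \<in> S" "f y = 1" "z = y ^ 2"
proof -
  define K where "K = {z \<in> S. f z = 1}"
  have m1: "- 1 \<in> R" using R_diff[OF R_0 R_1] by simp
  have "f (1 * - 1) - f (1 * 1) \<in> S"
    using m1 R_1 one_neq_minus_1 by (intro image_clique one_in_S) auto
  then have m1': "f (- 1) \<noteq> 1" using f_1 by auto
  have "inj_on (\<lambda>y. y ^ 2) K"
  proof (rule inj_onI)
    fix x y assume xy: "x \<in> K" "y \<in> K" "x ^ 2 = y ^ 2"
    \<comment> \<open>The quotient \<open>x / y\<close> is again in the kernel, whereas
      \<open>f (- 1) \<noteq> 1\<close>.\<close>
    have "- 1 \<noteq> x / y"
      using f_divide_S[of x y] xy m1' unfolding K_def by auto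
    moreover have "y \<noteq> 0" using xy S_neq_0 unfolding K_def by auto
    ultimately have "x \<noteq> - y" by (auto simp: field_simps)
    then show "x = y" using xy(3) by (simp add: power2_eq_iff)
  qed
  moreover have "(\<lambda>y. y ^ 2) ` K \<subseteq> K"
    unfolding K_def by (auto simp: f_square[OF norm_eq] intro!: square_in_S S_neq_0)
  ultimately have "(\<lambda>y. y ^ 2) ` K = K" by (intro endo_inj_surj) auto
  then show ?thesis using assms that unfolding K_def by blast
qed

text \<open>If \<open>f c\<close> were in \<open>S\<close>, it would still lie outside the image of
  \<open>R\<close>. The sums of \<open>\<chi> (c - x)\<close> and \<open>\<chi> (f c - f x)\<close>
  over \<open>R\<close> are then both -1, yet the second dominates termwise, strictly at 0.\<close>

lemma f_in_N:
  assumes c: "c \<in> N"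
  shows "f c \<in> N"
proof (rule ccontr)
  assume notN: "f c \<notin> N"
  have c0: "c \<noteq> 0" using N_neq_0 c by blast
  have fc: "f c \<in> S" using notN f_neq_0[OF f_zero c0] by (auto simp: in_N_iff)
  have "f c \<noteq> f t" if t: "t \<in> S" for t
  proof
    assume eq: "f c = f t"
    have t0: "t \<noteq> 0" using t S_neq_0 by blast
    \<comment> \<open>\<open>(c / t) ^ 2\<close> lies in the kernel, so it has a square root there,
      which forces \<open>c / t\<close> into \<open>S\<close>.\<close>
    have "f ((c / t) ^ 2) = f (c ^ 2 / t ^ 2)" by (simp add: power_divide)
    also have "\<dots> = 1"
      using f_divide_S[OF square_in_S[OF c0] square_in_S[OF t0]] eq S_neq_0[OF f_S[OF t]]
      by (simp add: f_square[OF norm_eq])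
    finally obtain y where y: "y \<in> S" "(c / t) ^ 2 = y ^ 2"
      using kernel_square_root square_in_S c0 t0 by (metis divide_eq_0_iff)
    then have "c / t = y \<or> c / t = - y" by (simp add: power2_eq_iff)
    then have "c / t \<in> S" using y by (auto simp: S_uminus)
    then have "c / t * t \<in> S" using t by (simp add: S_mult_iff del: times_divide_eq_left)
    then show False using t0 c S_not_N by simp
  qed
  then have ne: "f c \<noteq> f (1 * x)" if "x \<in> R" for x
    using that R_subset_S[of x] f_zero S_neq_0[OF fc] by (cases "x = 0") auto
  have "(\<Sum>x\<in>R. \<chi> (c - 1 * x)) < (\<Sum>x\<in>R. \<chi> (f c - f (1 * x)))"
  proof (rule sum_strict_mono_ex1)
    show "\<forall>x\<in>R. \<chi> (c - 1 * x) \<le> \<chi> (f c - f (1 * x))"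
    proof
      fix x assume x: "x \<in> R"
      show "\<chi> (c - 1 * x) \<le> \<chi> (f c - f (1 * x))"
      proof (cases "x = 0")
        case True
        then show ?thesis using c fc f_zero by (simp add: N_chi S_chi)
      next
        case False
        then have xS: "x \<in> S" using R_subset_S x by blast
        then have "c - x \<noteq> 0" using c S_not_N by auto
        moreover have "\<chi> (c - x) = 1 \<Longrightarrow> \<chi> (f c - f x) = 1"
          using edge[OF xS, of c] by (simp add: S_chi)
        ultimately show ?thesis using chi_cases[of "c - x"] chi_abs_le(2)[of "f c - f x"] by auto
      qed
    qed
    show "\<exists>x\<in>R. \<chi> (c - 1 * x) < \<chi> (f c - f (1 * x))"
      using R_0 c fc f_zero by (intro bexI[of _ 0]) (auto simp: N_chi S_chi)
  qed simp
  then show False using sum_line[OF one_in_S c] sum_image_line[OF one_in_S ne] by simp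
qed

text \<open>By \<open>edge\<close>, passing to the image cannot decrease any term of the sum over
  the line \<open>s R\<close>; both sums are -1, so all terms agree, in particular at
  \<open>x = 1\<close>.\<close>

lemma chi_f_diff:
  assumes c: "c \<in> N" and s: "s \<in> S"
  shows "\<chi> (f c - f s) = \<chi> (c - s)"
proof (rule ccontr)
  assume neq: "\<not> ?thesis"
  have fc: "f c \<in> N" using f_in_N[OF c] .
  have le: "\<chi> (c - s * x) \<le> \<chi> (f c - f (s * x))" if x: "x \<in> R" for x
  proof (cases "x = 0")
    case True
    then show ?thesis using c fc f_zero by (simp add: N_chi)
  next
    case False
    then have xS: "s * x \<in> S" using R_subset_S x s by (simp add: S_mult_iff)
    then have "c - s * x \<noteq> 0" using c S_not_N by auto
    moreover have "\<chi> (c - s * x) = 1 \<Longrightarrow> \<chi> (f c - f (s * x)) = 1"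
      using edge[OF xS, of c] by (simp add: S_chi)
    ultimately show ?thesis
      using chi_cases[of "c - s * x"] chi_abs_le(2)[of "f c - f (s * x)"] by auto
  qed
  have "(\<Sum>x\<in>R. \<chi> (c - s * x)) < (\<Sum>x\<in>R. \<chi> (f c - f (s * x)))"
    using le[OF R_1] neq by (intro sum_strict_mono_ex1 ballI le bexI[OF _ R_1]) auto
  moreover have "f c \<noteq> f (s * x)" if x: "x \<in> R" for x
  proof (cases "x = 0")
    case True
    then show ?thesis using f_zero N_neq_0[OF fc] by simp
  next
    case False
    then have "s * x \<in> S" using R_subset_S x s by (simp add: S_mult_iff)
    then show ?thesis using f_S fc S_not_N by metis
  qed
  ultimately show False using sum_line[OF s c] sum_image_line[OF s] by simp
qed

text \<open>For \<open>z\<close> in the kernel, \<open>f (s / z) = f s\<close>, so \<open>c\<close>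
  and \<open>z * c\<close> have the same neighbours in \<open>S\<close> for \<open>c\<close> in
  \<open>N\<close>; hence \<open>z = 1\<close>.\<close>

lemma inj_on_S: "inj_on f S"
proof (rule inj_onI)
  fix a b assume ab: "a \<in> S" "b \<in> S" "f a = f b"
  define z where "z = a / b"
  have z: "z \<in> S" "f z = 1"
    using ab f_divide_S S_neq_0[OF f_S] by (auto simp: z_def S_divide)
  have z0: "z \<noteq> 0" using z S_neq_0 by blast
  obtain c where c: "c \<in> N" by (rule N_nonempty)
  have cz: "z * c \<in> N" using c z by (simp add: S_mult_N)
  have "c = z * c"
  proof (rule twin_N[OF c cz])
    fix s assume s: "s \<in> S"
    have sz: "s / z \<in> S" using s z by (simp add: S_divide)
    have "\<chi> (z * c - s) = \<chi> (z * (c - s / z))" using z0 by (simp add: right_diff_distrib)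
    also have "\<dots> = \<chi> (c - s / z)" using z by (simp add: chi_mult S_chi)
    also have "\<dots> = \<chi> (f c - f s)"
      using chi_f_diff[OF c sz] f_divide_S[OF s z(1)] z(2) by simp
    also have "\<dots> = \<chi> (c - s)" by (rule chi_f_diff[OF c s])
    finally show "\<chi> (c - s) = \<chi> (z * c - s)" by simp
  qed
  then have "z = 1" using N_neq_0[OF c] by simp
  then show "a = b" using S_neq_0[OF ab(2)] by (simp add: z_def)
qed

theorem eq_frob:
  obtains l where "l \<le> k - 1" "\<And>x. f x = x ^ p ^ l"
  using imp_frob[OF inj_on_S f_in_N f_zero norm_eq] by blast

end

section \<open>Matrices with prescribed leading principal minors\<close>

lemma det_mat_1: "det (mat 1 1 g) = g (0, 0)"
  by (subst det_single) auto

lemma det_mat_2: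
  fixes g :: "nat \<times> nat \<Rightarrow> 'a :: comm_ring_1"
  shows "det (mat 2 2 g) = g (0, 0) * g (1, 1) - g (0, 1) * g (1, 0)"
proof -
  have "det (mat 2 2 g) = (\<Sum>j<2. mat 2 2 g $$ (0, j) * cofactor (mat 2 2 g) 0 j)"
    by (rule laplace_expansion_row) auto
  then show ?thesis
    by (simp add: numeral_2_eq_2 cofactor_def mat_delete_def det_mat_1[unfolded One_nat_def])
qed

lemma det_mat_3:
  fixes g :: "nat \<times> nat \<Rightarrow> 'a :: comm_ring_1"
  shows "det (mat 3 3 g) = g (0, 0) * (g (1, 1) * g (2, 2) - g (1, 2) * g (2, 1))
    - g (0, 1) * (g (1, 0) * g (2, 2) - g (1, 2) * g (2, 0))
    + g (0, 2) * (g (1, 0) * g (2, 1) - g (1, 1) * g (2, 0))"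
proof -
  have "det (mat 3 3 g) = (\<Sum>j<3. mat 3 3 g $$ (0, j) * cofactor (mat 3 3 g) 0 j)"
    by (rule laplace_expansion_row) auto
  then show ?thesis
    by (simp add: numeral_3_eq_3 numeral_2_eq_2 cofactor_def mat_delete_def
        det_mat_2[unfolded numeral_2_eq_2]) (simp add: algebra_simps)
qed

lemma leading_principal_minor_cong:
  assumes "\<And>i j. i < k \<Longrightarrow> j < k \<Longrightarrow> A $$ (i, j) = B $$ (i, j)"
  shows "leading_principal_minor k A = leading_principal_minor k B"
  unfolding leading_principal_minor_def using assms by (intro arg_cong[of _ _ det] eq_matI) auto

lemma leading_principal_minor_full:
  assumes "A \<in> carrier_mat n n"
  shows "leading_principal_minor n A = det A"
  unfolding leading_principal_minor_def using assms by (intro arg_cong[of _ _ det] eq_matI) auto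

lemma Frob_funpow: "(Frob p ^^ l) x = x ^ p ^ l"
  by (induction l) (simp_all add: Frob_def mult.commute flip: power_mult)

context one_mod_four_field
begin

text \<open>Take the block sum of \<open>A\<close> with the entry \<open>d / det A\<close>, where
  \<open>d\<close> has the prescribed character. The signs are nonzero, and the empty determinant is
  1, so \<open>det A \<noteq> 0\<close>.\<close>

lemma LPM_extend_Suc:
  fixes A :: "'a mat"
  assumes \<epsilon>: "\<epsilon> \<in> sign_patterns n" and m': "m' < n" and A: "A \<in> LPM m' \<epsilon>"
  obtains B where "B \<in> LPM (Suc m') \<epsilon>" "\<And>i j. i < m' \<Longrightarrow> j < m' \<Longrightarrow> B $$ (i, j) = A $$ (i, j)"
proof -
  have sign: "\<epsilon> i = 1 \<or> \<epsilon> i = -1" if "i \<in> {1..n}" for i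
    using \<epsilon> that unfolding sign_patterns_def by (auto simp: PiE_iff)
  have carrier: "A \<in> carrier_mat m' m'" and sym: "transpose_mat A = A"
    and minors: "\<And>i. i \<in> {1..m'} \<Longrightarrow> \<chi> (leading_principal_minor i A) = \<epsilon> i"
    using A unfolding LPM_def by auto
  have "det A \<noteq> 0"
  proof (cases "m' = 0")
    case False
    then have "\<chi> (det A) = \<epsilon> m'"
      using minors[of m'] leading_principal_minor_full[OF carrier] by simp
    then show ?thesis using sign[of m'] False m' by auto
  qed (use carrier in simp)
  obtain d :: 'a where d: "\<chi> d = \<epsilon> (Suc m')"
    using sign[of "Suc m'"] m' N_nonempty chi_1 unfolding N_chi
    by (metis Suc_leI atLeastAtMost_iff le_add1 plus_1_eq_Suc)
  define D where "D = mat 1 1 (\<lambda>_. d / det A)"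
  define B where "B = four_block_mat A (0\<^sub>m m' 1) (0\<^sub>m 1 m') D"
  have D: "D \<in> carrier_mat 1 1" by (simp add: D_def)
  have B: "B \<in> carrier_mat (Suc m') (Suc m')"
    using four_block_carrier_mat[OF carrier D] by (simp add: B_def)
  have agree: "B $$ (i, j) = A $$ (i, j)" if "i < m'" "j < m'" for i j
    using that carrier by (simp add: B_def D_def)
  have "det B = det A * det D"
    unfolding B_def by (rule det_four_block_mat_lower_left_zero[OF carrier _ _ D]) auto
  also have "\<dots> = d" using \<open>det A \<noteq> 0\<close> by (simp add: D_def det_mat_1[unfolded One_nat_def])
  finally have det: "det B = d" .
  have "B \<in> LPM (Suc m') \<epsilon>"
    unfolding LPM_def
  proof (intro CollectI conjI ballI)
    show "transpose_mat B = B"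
      unfolding B_def by (subst transpose_four_block_mat[OF carrier _ _ D]) (auto simp: sym D_def)
    fix i assume i: "i \<in> {1..Suc m'}"
    show "\<chi> (leading_principal_minor i B) = \<epsilon> i"
    proof (cases "i = Suc m'")
      case True
      then show ?thesis using leading_principal_minor_full[OF B] det d by simp
    next
      case False
      then have "leading_principal_minor i B = leading_principal_minor i A"
        using i by (intro leading_principal_minor_cong agree) auto
      then show ?thesis using minors[of i] i False by simp
    qed
  qed (rule B)
  then show ?thesis using agree that by blast
qed

lemma LPM_extend:
  fixes A :: "'a mat"
  assumes \<epsilon>: "\<epsilon> \<in> sign_patterns n" and m': "m' \<le> n" and A: "A \<in> LPM m' \<epsilon>"
  shows "\<exists>B \<in> LPM n \<epsilon>. \<forall>i<m'. \<forall>j<m'. B $$ (i, j) = A $$ (i, j)"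
  using m' A
proof (induction arbitrary: A rule: inc_induct)
  case (step l)
  obtain B where "B \<in> LPM (Suc l) \<epsilon>" "\<And>i j. i < l \<Longrightarrow> j < l \<Longrightarrow> B $$ (i, j) = A $$ (i, j)"
    using LPM_extend_Suc[OF \<epsilon> step.hyps(2) step.prems] by blast
  then show ?case using step.IH[of B] by (metis less_SucI)
qed auto

lemma LPM_nonempty:
  assumes "\<epsilon> \<in> sign_patterns n"
  obtains A :: "'a mat" where "A \<in> LPM n \<epsilon>"
proof -
  have "(mat 0 0 (\<lambda>_. 0) :: 'a mat) \<in> LPM 0 \<epsilon>"
    unfolding LPM_def by (auto intro: eq_matI)
  then show ?thesis using LPM_extend[OF assms] that by blast
qed

text \<open>Passes the hypothesis on size \<open>n\<close> down to smaller sizes: an entrywise map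
  sends an extension of \<open>A\<close> to an extension of its image.\<close>

lemma map_mat_LPM_le:
  fixes f :: "'a \<Rightarrow> 'a"
  assumes \<epsilon>': "\<epsilon>' \<in> sign_patterns n" and f: "map_mat f \<in> LPM n \<epsilon>' \<rightarrow> LPM n \<epsilon>"
    and m': "m' \<le> n" and A: "A \<in> LPM m' \<epsilon>'" and i: "i \<in> {1..m'}"
  shows "\<chi> (leading_principal_minor i (map_mat f A)) = \<epsilon> i"
proof -
  obtain B where B: "B \<in> LPM n \<epsilon>'" "\<forall>i<m'. \<forall>j<m'. B $$ (i, j) = A $$ (i, j)"
    using LPM_extend[OF \<epsilon>' m' A] by blast
  have carrier: "A \<in> carrier_mat m' m'" "B \<in> carrier_mat n n" using A B unfolding LPM_def by auto
  have "leading_principal_minor i (map_mat f A) = leading_principal_minor i (map_mat f B)"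
    using B(2) carrier i m' by (intro leading_principal_minor_cong) auto
  moreover have "map_mat f B \<in> LPM n \<epsilon>" using f B by blast
  ultimately show ?thesis using i m' unfolding LPM_def by auto
qed

end

context one_mod_four_field_char
begin

text \<open>The map \<open>x ^ p ^ l\<close> is a ring homomorphism and commutes with
  \<open>det\<close>; the scalar contributes \<open>c ^ i\<close>, which is positive.\<close>

lemma chi_leading_principal_minor_frob:
  fixes A :: "'a mat"
  assumes c: "c \<in> S" and A: "A \<in> carrier_mat n n" and i: "i \<le> n"
  shows "\<chi> (leading_principal_minor i (map_mat (\<lambda>x. c * x ^ p ^ l) A)) = \<chi> (leading_principal_minor i A)"
proof -
  define \<phi> :: "'a \<Rightarrow> 'a" where "\<phi> x = x ^ p ^ l" for x
  have "0 < p ^ l" using p_gt_1 by simp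
  interpret comm_ring_hom \<phi>
    by unfold_locales
       (use \<open>0 < p ^ l\<close> in \<open>auto simp: \<phi>_def power_mult_distrib freshmans_dream'[of "p ^ l" l] CHAR_eq prime_p\<close>)
  have "mat i i (\<lambda>(i, j). map_mat (\<lambda>x. c * x ^ p ^ l) A $$ (i, j)) =
      c \<cdot>\<^sub>m map_mat \<phi> (mat i i (\<lambda>(i, j). A $$ (i, j)))"
    using A i by (intro eq_matI) (auto simp: \<phi>_def)
  then have "leading_principal_minor i (map_mat (\<lambda>x. c * x ^ p ^ l) A) =
      c ^ i * \<phi> (leading_principal_minor i A)"
    unfolding leading_principal_minor_def by simp
  then show ?thesis using c by (simp add: \<phi>_def chi_mult chi_power[of c] chi_frob S_chi)
qed

lemma scaled_frob_LPM:
  fixes f :: "'a \<Rightarrow> 'a"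
  assumes c: "c \<in> S" and f: "\<And>x. f x = c * x ^ p ^ l"
  shows "map_mat f \<in> LPM n \<epsilon> \<rightarrow> LPM n \<epsilon>"
proof
  fix A :: "'a mat" assume A: "A \<in> LPM n \<epsilon>"
  have f_eq: "f = (\<lambda>x. c * x ^ p ^ l)" using f by blast
  have "transpose_mat (map_mat f A) = map_mat f A"
    using A unfolding LPM_def by (auto simp: map_mat_transpose)
  then show "map_mat f A \<in> LPM n \<epsilon>"
    using A chi_leading_principal_minor_frob[OF c, of A n _ l] unfolding LPM_def f_eq by auto
qed

text \<open>The image of any matrix in the nonempty set \<open>LPM n \<epsilon>'\<close> realizes
  both sign patterns.\<close>

lemma frob_LPM_signs_eq:
  fixes f :: "'a \<Rightarrow> 'a"
  assumes \<epsilon>: "\<epsilon> \<in> sign_patterns n" and \<epsilon>': "\<epsilon>' \<in> sign_patterns n"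
    and f: "map_mat f \<in> LPM n \<epsilon>' \<rightarrow> LPM n \<epsilon>"
    and c: "c \<in> S" "\<And>x. f x = c * x ^ p ^ l"
  shows "\<epsilon>' = \<epsilon>"
proof -
  obtain A :: "'a mat" where A: "A \<in> LPM n \<epsilon>'" using LPM_nonempty[OF \<epsilon>'] .
  have "map_mat f A \<in> LPM n \<epsilon>'" "map_mat f A \<in> LPM n \<epsilon>"
    using A f scaled_frob_LPM[OF c] by blast+
  then have "\<And>i. i \<in> {1..n} \<Longrightarrow> \<epsilon>' i = \<epsilon> i" unfolding LPM_def by auto
  then show ?thesis
    using \<epsilon> \<epsilon>' unfolding sign_patterns_def by (intro PiE_ext) auto
qed

context
  fixes f :: "'a \<Rightarrow> 'a" and n :: nat and \<epsilon> \<epsilon>' :: "nat \<Rightarrow> int"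
  assumes \<epsilon>: "\<epsilon> \<in> sign_patterns n" and \<epsilon>': "\<epsilon>' \<in> sign_patterns n"
    and f: "map_mat f \<in> LPM n \<epsilon>' \<rightarrow> LPM n \<epsilon>"
    and n2: "2 \<le> n" and signs: "\<epsilon> 1 = 1" "\<epsilon> 2 = 1" "\<epsilon>' 1 = 1" "\<epsilon>' 2 = 1"
begin

lemma maps_positive:
  assumes a: "a \<in> S"
  shows "f a \<in> S"
proof -
  define A where "A = mat 1 1 (\<lambda>_. a)"
  have "A \<in> LPM 1 \<epsilon>'"
    unfolding LPM_def using a signs
    by (auto simp: A_def leading_principal_minor_def det_mat_1[unfolded One_nat_def] S_chi intro!: eq_matI)
  from map_mat_LPM_le[OF \<epsilon>' f _ this, of 1] show ?thesis
    using n2 signs by (simp add: A_def leading_principal_minor_def det_mat_1[unfolded One_nat_def] S_chi)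
qed

lemma maps_minor_2:
  assumes a: "a \<in> S" and b: "a * c - b ^ 2 \<in> S"
  shows "f a * f c - f b ^ 2 \<in> S"
proof -
  define A where "A = mat 2 2 (\<lambda>(i, j). [[a, b], [b, c]] ! i ! j)"
  \<comment> \<open>Stated for a general \<open>g\<close> so as to serve \<open>A\<close>, with the
    identity, as well as its image under \<open>f\<close>.\<close>
  have m: "leading_principal_minor i (map_mat g A) = (if i = 1 then g a else g a * g c - g b ^ 2)"
    if "i \<in> {1..2}" for g :: "'a \<Rightarrow> 'a" and i
  proof -
    have "i = 1 \<or> i = 2" using that by auto
    then show ?thesis
      by (elim disjE) (simp_all add: A_def leading_principal_minor_def det_mat_2 power2_eq_square
        det_mat_1[unfolded One_nat_def])
  qed
  have "A \<in> LPM 2 \<epsilon>'"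
    unfolding LPM_def
  proof (intro CollectI conjI ballI)
    show "transpose_mat A = A" by (rule eq_matI) (auto simp: A_def numeral_2_eq_2 less_Suc_eq)
    show "\<chi> (leading_principal_minor i A) = \<epsilon>' i" if "i \<in> {1..2}" for i
    proof -
      have "i = 1 \<or> i = 2" using that by auto
      moreover have "map_mat (\<lambda>x. x) A = A" by (rule eq_matI) auto
      ultimately show ?thesis using m[OF that, of "\<lambda>x. x"] a b signs by (auto simp: S_chi)
    qed
  qed (simp add: A_def)
  from map_mat_LPM_le[OF \<epsilon>' f _ this, of 2] show ?thesis
    using n2 signs m[of 2 f] by (simp add: S_chi)
qed

lemma maps_minor_3:
  assumes n3: "3 \<le> n" and signs3: "\<epsilon> 3 = 1" "\<epsilon>' 3 = 1"
    and a: "a \<in> S" and b: "a * c - b ^ 2 \<in> S"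
    and e: "a * (c * g - e ^ 2) - b * (b * g - d * e) + d * (b * e - c * d) \<in> S"
  shows "f a * (f c * f g - f e ^ 2) - f b * (f b * f g - f d * f e) + f d * (f b * f e - f c * f d) \<in> S"
proof -
  define A where "A = mat 3 3 (\<lambda>(i, j). [[a, b, d], [b, c, e], [d, e, g]] ! i ! j)"
  have m: "leading_principal_minor i (map_mat u A) = (if i = 1 then u a else if i = 2 then u a * u c - u b ^ 2
      else u a * (u c * u g - u e ^ 2) - u b * (u b * u g - u d * u e) + u d * (u b * u e - u c * u d))"
    if "i \<in> {1..3}" for u :: "'a \<Rightarrow> 'a" and i
  proof -
    have "i = 1 \<or> i = 2 \<or> i = 3" using that by auto
    then show ?thesis
      by (elim disjE) (simp_all add: A_def leading_principal_minor_def det_mat_2 det_mat_3 power2_eq_square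
        det_mat_1[unfolded One_nat_def] mult.commute[of "u e" "u d"])
  qed
  have "A \<in> LPM 3 \<epsilon>'"
    unfolding LPM_def
  proof (intro CollectI conjI ballI)
    show "transpose_mat A = A" by (rule eq_matI) (auto simp: A_def numeral_3_eq_3 less_Suc_eq)
    show "\<chi> (leading_principal_minor i A) = \<epsilon>' i" if "i \<in> {1..3}" for i
    proof -
      have "i = 1 \<or> i = 2 \<or> i = 3" using that by auto
      moreover have "map_mat (\<lambda>x. x) A = A" by (rule eq_matI) auto
      ultimately show ?thesis using m[OF that, of "\<lambda>x. x"] a b e signs signs3 by (auto simp: S_chi)
    qed
  qed (simp add: A_def)
  from map_mat_LPM_le[OF \<epsilon>' f _ this, of 3] show ?thesis
    using n3 signs3 m[of 3 f] by (simp add: S_chi)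
qed

lemma f_1_in_S: "f 1 \<in> S"
  using maps_positive one_in_S by blast

lemma f_1_neq_0: "f 1 \<noteq> 0"
  using f_1_in_S S_neq_0 by blast

lemma minor_preserver_normalized: "minor_preserver p k (\<lambda>x. f x / f 1)"
proof unfold_locales
  show "f 1 / f 1 = 1" using f_1_neq_0 by simp
  show "f x / f 1 \<in> S" if "x \<in> S" for x
    using maps_positive[OF that] f_1_in_S by (simp add: S_divide)
  fix a b c assume "a \<in> S" "a * c - b ^ 2 \<in> S"
  then have "f a * f c - f b ^ 2 \<in> S" by (rule maps_minor_2)
  moreover have "f a / f 1 * (f c / f 1) - (f b / f 1) ^ 2 = (f a * f c - f b ^ 2) / f 1 ^ 2"
    by (simp add: power2_eq_square diff_divide_distrib)
  ultimately show "f a / f 1 * (f c / f 1) - (f b / f 1) ^ 2 \<in> S"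
    using square_in_S[OF f_1_neq_0] by (simp add: S_divide)
qed

text \<open>Dividing \<open>f\<close> by \<open>f 1\<close> divides the order 3 determinant by the
  cube of \<open>f 1\<close>, which is positive because \<open>f 1\<close> is.\<close>

lemma minor3_preserver_normalized:
  assumes "3 \<le> n" "\<epsilon> 3 = 1" "\<epsilon>' 3 = 1"
  shows "minor3_preserver p k (\<lambda>x. f x / f 1)"
proof -
  interpret g: minor_preserver ty p k "\<lambda>x. f x / f 1" by (rule minor_preserver_normalized)
  show ?thesis
  proof unfold_locales
    fix a b c d e g :: 'a
    let ?D = "\<lambda>u. u a * (u c * u g - u e ^ 2) - u b * (u b * u g - u d * u e) + u d * (u b * u e - u c * u d)"
    assume "a \<in> S" "a * c - b ^ 2 \<in> S" "?D (\<lambda>x. x) \<in> S"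
    then have "?D f \<in> S" by (rule maps_minor_3[OF assms])
    moreover have "?D (\<lambda>x. f x / f 1) = ?D f / (f 1 * f 1 ^ 2)"
      using f_1_neq_0 by (simp add: power2_eq_square add_divide_distrib diff_divide_distrib algebra_simps)
    moreover have "f 1 * f 1 ^ 2 \<in> S"
      using f_1_in_S square_in_S[OF f_1_neq_0] by (simp add: S_mult_iff)
    ultimately show "?D (\<lambda>x. f x / f 1) \<in> S" by (simp only: S_divide)
  qed
qed

lemma LPM_preserver_conclusion:
  assumes "\<exists>l\<le>k - 1. \<forall>x. f x / f 1 = x ^ p ^ l"
  shows "\<epsilon>' = \<epsilon> \<and> (\<exists>l c. l \<le> k - 1 \<and> c \<in> S \<and> f = (\<lambda>x. c * (Frob p ^^ l) x))"
proof -
  obtain l where l: "l \<le> k - 1" "\<And>x. f x / f 1 = x ^ p ^ l" using assms by blast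
  have f_eq: "f x = f 1 * x ^ p ^ l" for x
    using l(2)[of x] f_1_neq_0 by (simp add: field_simps)
  then have "f = (\<lambda>x. f 1 * (Frob p ^^ l) x)"
    unfolding Frob_funpow by (rule ext)
  then show ?thesis
    by (intro conjI exI[of _ l] exI[of _ "f 1"] frob_LPM_signs_eq[OF \<epsilon> \<epsilon>' f f_1_in_S f_eq] l(1) f_1_in_S)
qed

lemma LPM_preserver_3:
  assumes "3 \<le> n" "\<epsilon> 3 = 1" "\<epsilon>' 3 = 1"
  shows "\<epsilon>' = \<epsilon> \<and> (\<exists>l c. l \<le> k - 1 \<and> c \<in> S \<and> f = (\<lambda>x. c * (Frob p ^^ l) x))"
proof -
  interpret g: minor3_preserver ty p k "\<lambda>x. f x / f 1" by (rule minor3_preserver_normalized[OF assms])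
  show ?thesis using g.eq_frob by (intro LPM_preserver_conclusion) metis
qed

lemma LPM_preserver_square:
  assumes "is_square (CARD('a))"
  shows "\<epsilon>' = \<epsilon> \<and> (\<exists>l c. l \<le> k - 1 \<and> c \<in> S \<and> f = (\<lambda>x. c * (Frob p ^^ l) x))"
proof -
  obtain r where r: "CARD('a) = r ^ 2" using assms by (rule is_nth_powerE)
  interpret g: minor_preserver ty p k "\<lambda>x. f x / f 1" by (rule minor_preserver_normalized)
  interpret g: square_minor_preserver ty p k "\<lambda>x. f x / f 1" r by unfold_locales (rule r)
  show ?thesis using g.eq_frob by (intro LPM_preserver_conclusion) metis
qed

end

lemma LPM_preserver_converse:
  fixes f :: "'a \<Rightarrow> 'a"
  assumes "\<epsilon>' = \<epsilon> \<and> (\<exists>l c. l \<le> k - 1 \<and> c \<in> S \<and> f = (\<lambda>x. c * (Frob p ^^ l) x))"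
  shows "map_mat f \<in> LPM n \<epsilon>' \<rightarrow> LPM n \<epsilon>"
proof -
  obtain l c where "c \<in> S" "\<And>x. f x = c * x ^ p ^ l" "\<epsilon>' = \<epsilon>"
    using assms by (auto simp: Frob_funpow)
  then show ?thesis using scaled_frob_LPM by blast
qed

end

theorem theorem1p9:
  fixes f :: "'a::finite_field \<Rightarrow> 'a"
    and p k n :: nat
    and \<epsilon> \<epsilon>' :: "nat \<Rightarrow> int"
  assumes "prime p"
    and "CARD('a) = p ^ k"
    and "CARD('a) mod 4 = 1"
    and "\<epsilon> \<in> sign_patterns n"
    and "\<epsilon>' \<in> sign_patterns n"
  shows "(\<forall>s. 3 \<le> s \<longrightarrow> s \<le> n \<longrightarrow> (\<forall>i\<in>{1..s}. \<epsilon> i = 1 \<and> \<epsilon>' i = 1) \<longrightarrow>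
            (map_mat f \<in> LPM n \<epsilon>' \<rightarrow> LPM n \<epsilon> \<longleftrightarrow>
              \<epsilon>' = \<epsilon> \<and>
              (\<exists>l c. l \<le> k - 1 \<and> c \<in> positive_elements \<and> f = (\<lambda>x. c * (Frob p ^^ l) x))))
       \<and> (is_square (CARD('a)) \<longrightarrow> 2 \<le> n \<longrightarrow> (\<forall>i\<in>{1..2}. \<epsilon> i = 1 \<and> \<epsilon>' i = 1) \<longrightarrow>
            (map_mat f \<in> LPM n \<epsilon>' \<rightarrow> LPM n \<epsilon> \<longleftrightarrow>
              \<epsilon>' = \<epsilon> \<and>
              (\<exists>l c. l \<le> k - 1 \<and> c \<in> positive_elements \<and> f = (\<lambda>x. c * (Frob p ^^ l) x))))"
proof -
  interpret one_mod_four_field_char "TYPE('a)" p k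
    by unfold_locales (use assms in auto)
  show ?thesis
  proof (intro conjI allI impI)
    fix s :: nat assume s: "3 \<le> s" "s \<le> n" "\<forall>i\<in>{1..s}. \<epsilon> i = 1 \<and> \<epsilon>' i = 1"
    have n: "2 \<le> n" "3 \<le> n" using s by auto
    have 1: "\<epsilon> 1 = 1" "\<epsilon> 2 = 1" "\<epsilon>' 1 = 1" "\<epsilon>' 2 = 1" "\<epsilon> 3 = 1" "\<epsilon>' 3 = 1"
      using s by auto
    show "map_mat f \<in> LPM n \<epsilon>' \<rightarrow> LPM n \<epsilon> \<longleftrightarrow> \<epsilon>' = \<epsilon> \<and>
        (\<exists>l c. l \<le> k - 1 \<and> c \<in> positive_elements \<and> f = (\<lambda>x. c * (Frob p ^^ l) x))"
      using LPM_preserver_3[OF assms(4,5) _ n(1) 1(1-4) n(2) 1(5,6)] LPM_preserver_converse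
      by (intro iffI)
  next
    assume sq: "is_square (CARD('a))" "2 \<le> n" "\<forall>i\<in>{1..2}. \<epsilon> i = 1 \<and> \<epsilon>' i = 1"
    have 1: "\<epsilon> 1 = 1" "\<epsilon> 2 = 1" "\<epsilon>' 1 = 1" "\<epsilon>' 2 = 1" using sq(3) by auto
    show "map_mat f \<in> LPM n \<epsilon>' \<rightarrow> LPM n \<epsilon> \<longleftrightarrow> \<epsilon>' = \<epsilon> \<and>
        (\<exists>l c. l \<le> k - 1 \<and> c \<in> positive_elements \<and> f = (\<lambda>x. c * (Frob p ^^ l) x))"
      using LPM_preserver_square[OF assms(4,5) _ sq(2) 1 sq(1)] LPM_preserver_converse
      by (intro iffI)
  qed
qed

end
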